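(* In the setting of the context, suppose $\mathcal M_{\bar c}$ satisfies the nondegeneracy condition $\mathrm{Null}(A)=\{0\}$, and that $c\in\mathcal M_{\bar c}$ and $y\in\partial h(c)$ are such that $k$-strict complementarity holds at $(c,y)$ (for some $\mu$). Then $h$ is partly smooth relative to $\mathcal M_{\bar c}$.
   Context: Representation of $h$. $h:\mathbb{R}^m\to\mathbb{R}\cup\{+\infty\}$ is a proper convex function with $\mathrm{int}\,\mathrm{dom}(h)\neq\emptyset$ and $\mathrm{dom}(h)=\bigcup_{k=1}^{\mathcal K}C_k$, where on each $C_k$, $h(c)=\frac12\langle c,Q_kc\rangle+\langle b_k,c\rangle+\beta_k$ ($Q_k$ symmetric), and there are $(a_j,\alpha_j)\in(\mathbb{R}^m\setminus\{0\})\times\mathbb{R}$, $j=1,\dots,s$, and $\omega_{kj}\in\{\pm1\}$ with $C_k=\{c:\langle\omega_{kj}a_j,c\rangle\le\omega_{kj}\alpha_j,\ j=1,\dots,s\}$, $\mathrm{int}\,C_k=\{c:\langle\omega_{kj}a_j,c\rangle<\omega_{kj}\alpha_j,\ j=1,\dots,s\}\ne\emptyset$, and $\mathrm{int}\,C_{k_1}\cap\mathrm{int}\,C_{k_2}=\emptyset$ for $k_1\ne k_2$. Let $\mathcal K(c)=\{k:c\in C_k\}$ and $I_k(c)=\{j:\langle a_j,c\rangle=\alpha_j\}$. Active manifold and matrices. $\bar c\in\mathrm{dom}(h)$, $\mathcal K(\bar c)=\{k_1,\dots,k_{\bar k}\}$ with $\bar k\ge2$, $\mathcal M_{\bar c}:=\mathrm{ri}\big(\bigcap_{k\in\mathcal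 K(\bar c)}C_k\big)$, with $\bar c\in\mathcal M_{\bar c}$. Let $\ell=|I_k(\bar c)|$ (independent of $k\in\mathcal K(\bar c)$; active index sets are constant on $\mathcal M_{\bar c}$). $A\in\mathbb{R}^{m\times\ell}$ has columns $\omega_{k_{\bar k}j}a_j$, $j\in I_{k_{\bar k}}(\bar c)$, in a fixed order, and $P_i$ ($i=1,\dots,\bar k$) is the $\ell\times\ell$ diagonal matrix with $\pm1$ entries such that $AP_i$ has columns $\omega_{k_ij}a_j$ in the same order ($P_{\bar k}=I$). $k$-strict complementarity at $(c,y)$ for $\mu=(\mu_1^\top,\dots,\mu_{\bar k}^\top)^\top\in\mathbb{R}^{\bar k\ell}$ ($\mu_i\in\mathbb{R}^\ell$ belonging to $C_{k_i}$) means: (a) $c\in\mathcal M_{\bar c}$, $y\in\partial h(c)$; (b) there is $i_0\in\{1,\dots,\bar k\}$ with $\mu_{i_0}>0$ componentwise; (c) whenever there are $i\in\{1,\dots,\bar k\}\setminus\{i_0\}$ and $p\in\{1,\dots,\ell\}$ with $(\mu_i)_p=0$, then $(P_{i'})_{pp}=1$ for all $i'\in\{1,\dots,\bar k\}$; (d) $\mu\ge0$ and $y=Q_{k_i}c+b_{k_i}+AP_i\mu_i$ for all $i\in\{1,\dots,\bar k\}$. A set $\mathcal M\subset\mathbb{R}^m$ is a manifold around $c_0\in\mathcal M$ (of codimension $r$) if there are an open $V\ni c_0$ and a $C^2$ map $F:V\to\mathbb{R}^r$ with surjective derivative throughout $V$ such that $\mathcal M\cap V=\{c\in V:F(c)=0\}$;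 $\mathcal M$ is a manifold if this holds around each of its points. Its normal space at $c_0$ is $N(c_0|\mathcal M)=\mathrm{Ran}(\nabla F(c_0)^\top)$. For a convex set $C$, $\mathrm{par}(C)$ is the subspace parallel to its affine hull. A closed proper convex $h$ is partly smooth at $c_0$ relative to $\mathcal M$ if $\mathcal M$ is a manifold around $c_0$ and: (a) there are a neighborhood $V$ of $c_0$ and a $C^2$ function on $V$ agreeing with $h$ on $V\cap\mathcal M$; (b) $\partial h(c)\ne\emptyset$ for all $c\in\mathcal M$ near $c_0$; (c) $\mathrm{par}(\partial h(c_0))=N(c_0|\mathcal M)$; (d) $\partial h$ is inner semicontinuous at $c_0$ relative to $\mathcal M$, i.e. for every $u\in\partial h(c_0)$ and every sequence $c^\nu\to c_0$ in $\mathcal M$ there exist $u^\nu\to u$ with $u^\nu\in\partial h(c^\nu)$ for all large $\nu$. $h$ is partly smooth relative to $\mathcal M$ if $\mathcal M$ is a manifold and $h$ is partly smooth at each point of $\mathcal M$ relative to $\mathcal M$. *)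

theory Defs
  imports "HOL-Analysis.Analysis"
begin

section \<open>Extended-real-valued convex functions\<close>

definition edom :: "('a \<Rightarrow> ereal) \<Rightarrow> 'a set" where
  "edom h = {x. h x < \<infinity>}"

definition epi :: "('a \<Rightarrow> ereal) \<Rightarrow> ('a \<times> real) set" where
  "epi h = {(x, r). h x \<le> ereal r}"

definition proper :: "('a \<Rightarrow> ereal) \<Rightarrow> bool" where
  "proper h \<longleftrightarrow> (\<forall>x. h x \<noteq> -\<infinity>) \<and> edom h \<noteq> {}"

definition closed_proper_convex :: "('a::euclidean_space \<Rightarrow> ereal) \<Rightarrow> bool" where
  "closed_proper_convex h \<longleftrightarrow> closed (epi h) \<and> proper h \<and> convex (epi h)"

definition subdiff :: "('a::real_inner \<Rightarrow> ereal) \<Rightarrow> 'a \<Rightarrow> 'a set" where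
  "subdiff h c = {y. c \<in> edom h \<and> (\<forall>x. h c + ereal (y \<bullet> (x - c)) \<le> h x)}"

definition par :: "'a::real_vector set \<Rightarrow> 'a set" where
  "par C = (THE L. subspace L \<and> affine_parallel (affine hull C) L)"

section \<open>Manifolds\<close>

definition C2_on :: "(real^'m) set \<Rightarrow> (real^'m \<Rightarrow> real) \<Rightarrow> bool" where
  "C2_on V f \<longleftrightarrow> (\<exists>g (H :: real^'m \<Rightarrow> real^'m^'m).
     (\<forall>x\<in>V. GDERIV f x :> g x \<and> (g has_derivative (\<lambda>v. H x *v v)) (at x)) \<and>
     continuous_on V H)"

definition grad :: "('a::real_inner \<Rightarrow> real) \<Rightarrow> 'a \<Rightarrow> 'a" where
  "grad f x = (THE D. GDERIV f x :> D)"

text \<open>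
  A map from \<open>V\<close> to \<open>\<real>\<^sup>r\<close> is given by its components \<open>F i\<close>, \<open>i < r\<close>, so its derivative at
  \<open>x\<close> sends \<open>v\<close> to the vector with entries \<open>grad (F i) x \<bullet> v\<close>, and the range of the transposed
  derivative consists of the linear combinations of the \<open>grad (F i) x\<close>.
\<close>

definition defining_map ::
  "(real^'m) set \<Rightarrow> real^'m \<Rightarrow> nat \<Rightarrow> (real^'m) set \<Rightarrow> (nat \<Rightarrow> real^'m \<Rightarrow> real) \<Rightarrow> bool" where
  "defining_map M c0 r V F \<longleftrightarrow>
     open V \<and> c0 \<in> V \<and> (\<forall>i<r. C2_on V (F i)) \<and>
     (\<forall>x\<in>V. \<forall>w :: nat \<Rightarrow> real. \<exists>v. \<forall>i<r. grad (F i) x \<bullet> v = w i) \<and>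
     M \<inter> V = {x\<in>V. \<forall>i<r. F i x = 0}"

definition manifold_around :: "(real^'m) set \<Rightarrow> real^'m \<Rightarrow> bool" where
  "manifold_around M c0 \<longleftrightarrow> c0 \<in> M \<and> (\<exists>r V F. defining_map M c0 r V F)"

definition is_manifold :: "(real^'m) set \<Rightarrow> bool" where
  "is_manifold M \<longleftrightarrow> (\<forall>c0\<in>M. manifold_around M c0)"

text \<open>
  The range of the transposed derivative at \<open>c0\<close> is the same for all defining maps of \<open>M\<close>
  around \<open>c0\<close>.
\<close>

definition normal_space :: "real^'m \<Rightarrow> (real^'m) set \<Rightarrow> (real^'m) set" where
  "normal_space c0 M = (THE N. \<exists>r V F. defining_map M c0 r V F \<and>
     N = {\<Sum>i<r. w i *\<^sub>R grad (F i) c0 | w :: nat \<Rightarrow> real. True})"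

section \<open>Partial smoothness\<close>

definition inner_semicontinuous_at ::
  "(real^'m \<Rightarrow> (real^'m) set) \<Rightarrow> real^'m \<Rightarrow> (real^'m) set \<Rightarrow> bool" where
  "inner_semicontinuous_at S c0 M \<longleftrightarrow>
     (\<forall>u \<in> S c0. \<forall>X. (\<forall>n. X n \<in> M) \<and> X \<longlonglongrightarrow> c0 \<longrightarrow>
        (\<exists>U. U \<longlonglongrightarrow> u \<and> (\<forall>\<^sub>F n in sequentially. U n \<in> S (X n))))"

definition partly_smooth_at :: "(real^'m \<Rightarrow> ereal) \<Rightarrow> real^'m \<Rightarrow> (real^'m) set \<Rightarrow> bool" where
  "partly_smooth_at h c0 M \<longleftrightarrow>
     closed_proper_convex h \<and> manifold_around M c0 \<and>
     (\<exists>V f. open V \<and> c0 \<in> V \<and> C2_on V f \<and> (\<forall>x \<in> V \<inter> M. h x = ereal (f x))) \<and>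
     (\<forall>\<^sub>F c in nhds c0. c \<in> M \<longrightarrow> subdiff h c \<noteq> {}) \<and>
     par (subdiff h c0) = normal_space c0 M \<and>
     inner_semicontinuous_at (subdiff h) c0 M"

definition partly_smooth :: "(real^'m \<Rightarrow> ereal) \<Rightarrow> (real^'m) set \<Rightarrow> bool" where
  "partly_smooth h M \<longleftrightarrow> is_manifold M \<and> (\<forall>c0\<in>M. partly_smooth_at h c0 M)"

section \<open>Convex piecewise linear-quadratic functions\<close>

definition piece ::
  "nat \<Rightarrow> (nat \<Rightarrow> real^'m) \<Rightarrow> (nat \<Rightarrow> real) \<Rightarrow> (nat \<Rightarrow> nat \<Rightarrow> real) \<Rightarrow> nat \<Rightarrow> (real^'m) set" where
  "piece s a \<alpha> \<omega> k = {c. \<forall>j\<in>{1..s}. (\<omega> k j *\<^sub>R a j) \<bullet> c \<le> \<omega> k j * \<alpha> j}"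

locale plq_representation =
  fixes h :: "real^'m \<Rightarrow> ereal"
    and K s :: nat
    and Q :: "nat \<Rightarrow> real^'m^'m" and b :: "nat \<Rightarrow> real^'m" and \<beta> :: "nat \<Rightarrow> real"
    and a :: "nat \<Rightarrow> real^'m" and \<alpha> :: "nat \<Rightarrow> real" and \<omega> :: "nat \<Rightarrow> nat \<Rightarrow> real"
  assumes proper: "proper h"
    and convex: "convex (epi h)"
    and interior_dom: "interior (edom h) \<noteq> {}"
    and dom_eq: "edom h = (\<Union>k\<in>{1..K}. piece s a \<alpha> \<omega> k)"
    and Q_sym: "\<And>k. k \<in> {1..K} \<Longrightarrow> transpose (Q k) = Q k"
    and h_eq: "\<And>k c. k \<in> {1..K} \<Longrightarrow> c \<in> piece s a \<alpha> \<omega> k \<Longrightarrow>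
      h c = ereal (1/2 * (c \<bullet> (Q k *v c)) + b k \<bullet> c + \<beta> k)"
    and a_nonzero: "\<And>j. j \<in> {1..s} \<Longrightarrow> a j \<noteq> 0"
    and \<omega>_sign: "\<And>k j. k \<in> {1..K} \<Longrightarrow> j \<in> {1..s} \<Longrightarrow> \<omega> k j \<in> {-1, 1}"
    and interior_piece: "\<And>k. k \<in> {1..K} \<Longrightarrow> interior (piece s a \<alpha> \<omega> k) =
      {c. \<forall>j\<in>{1..s}. (\<omega> k j *\<^sub>R a j) \<bullet> c < \<omega> k j * \<alpha> j}"
    and interior_piece_nonempty: "\<And>k. k \<in> {1..K} \<Longrightarrow> interior (piece s a \<alpha> \<omega> k) \<noteq> {}"
    and interior_disjoint: "\<And>k1 k2. k1 \<in> {1..K} \<Longrightarrow> k2 \<in> {1..K} \<Longrightarrow> k1 \<noteq> k2 \<Longrightarrow>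
      interior (piece s a \<alpha> \<omega> k1) \<inter> interior (piece s a \<alpha> \<omega> k2) = {}"

definition active_pieces ::
  "nat \<Rightarrow> nat \<Rightarrow> (nat \<Rightarrow> real^'m) \<Rightarrow> (nat \<Rightarrow> real) \<Rightarrow> (nat \<Rightarrow> nat \<Rightarrow> real) \<Rightarrow> real^'m \<Rightarrow> nat set" where
  "active_pieces K s a \<alpha> \<omega> c = {k\<in>{1..K}. c \<in> piece s a \<alpha> \<omega> k}"

text \<open>The active constraints at \<open>c\<close> are the same for every piece containing \<open>c\<close>.\<close>

definition active_constraints ::
  "nat \<Rightarrow> (nat \<Rightarrow> real^'m) \<Rightarrow> (nat \<Rightarrow> real) \<Rightarrow> real^'m \<Rightarrow> nat set" where
  "active_constraints s a \<alpha> c = {j\<in>{1..s}. a j \<bullet> c = \<alpha> j}"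

definition active_manifold ::
  "nat \<Rightarrow> nat \<Rightarrow> (nat \<Rightarrow> real^'m) \<Rightarrow> (nat \<Rightarrow> real) \<Rightarrow> (nat \<Rightarrow> nat \<Rightarrow> real) \<Rightarrow> real^'m \<Rightarrow>
   (real^'m) set" where
  "active_manifold K s a \<alpha> \<omega> cbar =
     rel_interior (\<Inter>k\<in>active_pieces K s a \<alpha> \<omega> cbar. piece s a \<alpha> \<omega> k)"

text \<open>
  The active pieces at \<open>cbar\<close> are enumerated as \<open>\<kappa> 1, \<dots>, \<kappa> kbar\<close>, and the active constraints
  by \<open>e\<close> over the finite type \<open>'l\<close>, which indexes the columns of \<open>A\<close>. Two pieces with disjoint
  interiors meet at \<open>cbar\<close>, so some constraint is active there and a (nonempty) index type \<open>'l\<close>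
  exists.
\<close>

locale active_data = plq_representation h K s Q b \<beta> a \<alpha> \<omega>
  for h :: "real^'m \<Rightarrow> ereal" and K s :: nat
    and Q :: "nat \<Rightarrow> real^'m^'m" and b :: "nat \<Rightarrow> real^'m" and \<beta> :: "nat \<Rightarrow> real"
    and a :: "nat \<Rightarrow> real^'m" and \<alpha> :: "nat \<Rightarrow> real" and \<omega> :: "nat \<Rightarrow> nat \<Rightarrow> real" +
  fixes cbar :: "real^'m" and kbar :: nat and \<kappa> :: "nat \<Rightarrow> nat" and e :: "'l::finite \<Rightarrow> nat"
    and A :: "real^'l^'m" and P :: "nat \<Rightarrow> real^'l^'l"
  assumes cbar_dom: "cbar \<in> edom h"
    and \<kappa>_enum: "bij_betw \<kappa> {1..kbar} (active_pieces K s a \<alpha> \<omega> cbar)"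
    and kbar_ge_2: "2 \<le> kbar"
    and cbar_manifold: "cbar \<in> active_manifold K s a \<alpha> \<omega> cbar"
    and e_enum: "bij_betw e (UNIV :: 'l set) (active_constraints s a \<alpha> cbar)"
    and A_column: "\<And>p. column p A = \<omega> (\<kappa> kbar) (e p) *\<^sub>R a (e p)"
    and P_diagonal: "\<And>i p q. i \<in> {1..kbar} \<Longrightarrow> p \<noteq> q \<Longrightarrow> P i $ p $ q = 0"
    and P_sign: "\<And>i p. i \<in> {1..kbar} \<Longrightarrow> P i $ p $ p \<in> {-1, 1}"
    and AP_column: "\<And>i p. i \<in> {1..kbar} \<Longrightarrow>
      column p (A ** P i) = \<omega> (\<kappa> i) (e p) *\<^sub>R a (e p)"

text \<open>
  Here \<open>M\<close> is the active manifold and \<open>\<mu> i\<close>, for \<open>i\<close> in \<open>{1..kbar}\<close>, is the \<open>i\<close>-th block of the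
  multiplier vector.
\<close>

definition k_strict_complementarity ::
  "(real^'m \<Rightarrow> ereal) \<Rightarrow> (nat \<Rightarrow> real^'m^'m) \<Rightarrow> (nat \<Rightarrow> real^'m) \<Rightarrow> (real^'m) set \<Rightarrow>
   nat \<Rightarrow> (nat \<Rightarrow> nat) \<Rightarrow> real^'l^'m \<Rightarrow> (nat \<Rightarrow> real^'l^'l) \<Rightarrow>
   real^'m \<Rightarrow> real^'m \<Rightarrow> (nat \<Rightarrow> real^'l) \<Rightarrow> bool" where
  "k_strict_complementarity h Q b M kbar \<kappa> A P c y \<mu> \<longleftrightarrow>
     c \<in> M \<and> y \<in> subdiff h c \<and>
     (\<exists>i0\<in>{1..kbar}.
        (\<forall>p. 0 < \<mu> i0 $ p) \<and>
        (\<forall>i\<in>{1..kbar} - {i0}. \<forall>p. \<mu> i $ p = 0 \<longrightarrow> (\<forall>i'\<in>{1..kbar}. P i' $ p $ p = 1))) \<and>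
     (\<forall>i\<in>{1..kbar}. (\<forall>p. 0 \<le> \<mu> i $ p) \<and>
        y = Q (\<kappa> i) *v c + b (\<kappa> i) + (A ** P i) *v \<mu> i)"

end

theory Submission
  imports Defs
begin

text \<open>
  Near \<open>cbar\<close> every piece is an orthant in the coordinates given by the active constraints, whose
  normals are the columns of \<open>A\<close>, and \<open>M\<close> is a relatively open subset of the affine space on
  which they all hold with equality. In the basis \<open>d\<close> dual to the columns, \<open>subdiff h x\<close> for \<open>x\<close>
  in \<open>M\<close> is therefore a box in a translate of \<open>span (columns A)\<close>, the normal space of \<open>M\<close>: piece
  \<open>i\<close> bounds the \<open>p\<close>-th coordinate by \<open>G i x \<bullet> d p\<close>, from below or above according to the sign
  \<open>P i $ p $ p\<close>. By convexity of \<open>h\<close> no upper bound lies below a lower one, and the gaps are affine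
  in \<open>x\<close>, so a gap which is positive at one point of \<open>M\<close> is positive on all of \<open>M\<close>. Strict
  complementarity makes all gaps positive at \<open>c\<close>. Hence the boxes are full-dimensional and vary
  continuously, which gives the normal space condition and inner semicontinuity.
\<close>

section \<open>Normal spaces\<close>

text \<open>Turns the range in \<open>normal_space_def\<close> into a span, so that two candidates
  can be compared through the vectors orthogonal to them.\<close>

lemma linear_combinations_eq_span:
  fixes f :: "nat \<Rightarrow> 'a::real_vector"
  shows "{\<Sum>i<r. w i *\<^sub>R f i | w :: nat \<Rightarrow> real. True} = span (f ` {..<r})" (is "?L = _")
proof (rule antisym)
  show "?L \<subseteq> span (f ` {..<r})"
    by clarify (intro span_sum span_scale span_base imageI, assumption)
  have "f j \<in> ?L" if "j < r" for j
  proof -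
    have "(\<Sum>i<r. (if i = j then 1 else 0) *\<^sub>R f i) = (\<Sum>i<r. if i = j then f i else 0)"
      by (rule sum.cong) auto
    also have "\<dots> = f j"
      using that by simp
    finally show ?thesis
      by (intro CollectI exI[of _ "\<lambda>i. if i = j then 1 else 0"]) simp
  qed
  moreover have "subspace ?L"
  proof (rule subspaceI)
    show "0 \<in> ?L"
      by (intro CollectI exI[of _ "\<lambda>_. 0"]) simp
  next
    fix x y assume "x \<in> ?L" "y \<in> ?L"
    then obtain v w where "x = (\<Sum>i<r. v i *\<^sub>R f i)" "y = (\<Sum>i<r. w i *\<^sub>R f i)"
      by blast
    then show "x + y \<in> ?L"
      by (intro CollectI exI[of _ "\<lambda>i. v i + w i"]) (simp add: scaleR_left_distrib sum.distrib)
  next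
    fix t x assume "x \<in> ?L"
    then obtain v where "x = (\<Sum>i<r. v i *\<^sub>R f i)"
      by blast
    then show "t *\<^sub>R x \<in> ?L"
      by (intro CollectI exI[of _ "\<lambda>i. t * v i"]) (simp add: scaleR_sum_right)
  qed
  ultimately show "span (f ` {..<r}) \<subseteq> ?L"
    by (intro span_minimal) auto
qed

lemma grad_eqI:
  fixes f :: "'a::real_inner \<Rightarrow> real"
  assumes "GDERIV f x :> D"
  shows "grad f x = D"
  unfolding grad_def
proof (rule the_equality[where a = D])
  fix D' assume "GDERIV f x :> D'"
  then have "(\<lambda>h. h \<bullet> D') = (\<lambda>h. h \<bullet> D)"
    using assms has_derivative_unique unfolding gderiv_def by blast
  then show "D' = D"
    by (simp add: fun_eq_iff vector_eq_ldot)
qed (fact assms)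

lemma C2_on_has_derivative:
  assumes "C2_on V f" "x \<in> V"
  shows "(f has_derivative (\<lambda>v. grad f x \<bullet> v)) (at x)"
proof -
  from assms obtain g where "GDERIV f x :> g"
    unfolding C2_on_def by blast
  moreover from this have "grad f x = g"
    by (rule grad_eqI)
  ultimately show ?thesis
    by (simp add: gderiv_def inner_commute)
qed

text \<open>An injective linear endomorphism of a finite-dimensional space is invertible, so
  Sussmann's open mapping theorem applies at \<open>x\<close>.\<close>

lemma surjective_derivative_open_map:
  fixes f :: "'a::euclidean_space \<Rightarrow> 'a"
  assumes "open V" "x \<in> V" "continuous_on V f" "(f has_derivative T) (at x)"
    and "\<And>v. T v = 0 \<Longrightarrow> v = 0"
  shows "f x \<in> interior (f ` V)"
proof -
  have T: "linear T"
    using assms(4) has_derivative_linear by blast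
  then have "inj T"
    using assms(5) linear_injective_0 by blast
  then obtain T' where T': "linear T'" "\<And>v. T (T' v) = v"
    using T linear_injective_isomorphism by blast
  have "bounded_linear T'"
    using T'(1) linear_conv_bounded_linear by blast
  then show ?thesis
    using sussmann_open_mapping[OF assms(1,3,2,4), of T' V] assms(1,2) T'(2)
    by (simp add: interior_open fun_eq_iff)
qed

lemma orthogonal_sum_eq_0:
  fixes x y z :: "'a::real_inner"
  assumes "x + y + z = 0" "x \<bullet> y = 0" "x \<bullet> z = 0"
  shows "x = 0"
proof -
  have "x \<bullet> (x + y + z) = x \<bullet> x"
    using assms(2,3) by (simp add: inner_add_right)
  then show ?thesis
    using assms(1) by simp
qed

text \<open>
  If \<open>v\<close> is killed by every \<open>grad (F i) c0\<close> but not by \<open>grad (G j) c0\<close>, then the map \<open>\<Phi>\<close> below,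
  whose components are \<open>F\<close>, \<open>G j\<close> and coordinates on the common kernel, is open at \<open>c0\<close>. It thus
  attains a value with \<open>F = 0\<close> and \<open>G j \<noteq> 0\<close>, although \<open>F\<close> and \<open>G\<close> have the same zeros.
\<close>

lemma defining_map_kernel_subset:
  assumes F: "defining_map M c0 r V F" and G: "defining_map M c0 q W G" and c0: "c0 \<in> M"
    and v: "\<And>i. i < r \<Longrightarrow> grad (F i) c0 \<bullet> v = 0" and j: "j < q"
  shows "grad (G j) c0 \<bullet> v = 0"
proof (rule ccontr)
  assume nz: "grad (G j) c0 \<bullet> v \<noteq> 0"
  define g where "g i = grad (F i) c0" for i
  define k where "k = grad (G j) c0"
  define N where "N = {u. (\<forall>i<r. g i \<bullet> u = 0) \<and> k \<bullet> u = 0}"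
  have subN: "subspace N"
    by (auto simp: N_def subspace_def inner_right_distrib)
  obtain B where B: "B \<subseteq> N" "independent B" "span B = N"
    using basis_exists[of N] subN span_eq_iff by (metis basis_subspace_exists)
  have finB: "finite B"
    using B(2) independent_imp_finite by blast
  define \<Phi> where
    "\<Phi> x = (\<Sum>i<r. F i x *\<^sub>R g i) + G j x *\<^sub>R v + (\<Sum>b\<in>B. (b \<bullet> (x - c0)) *\<^sub>R b)" for x
  define T where
    "T u = (\<Sum>i<r. (g i \<bullet> u) *\<^sub>R g i) + (k \<bullet> u) *\<^sub>R v + (\<Sum>b\<in>B. (b \<bullet> u) *\<^sub>R b)" for u
  have openVW: "open (V \<inter> W)" and c0VW: "c0 \<in> V \<inter> W"
    using F G by (auto simp: defining_map_def)
  have dF: "(F i has_derivative (\<lambda>u. grad (F i) x \<bullet> u)) (at x)" if "i < r" "x \<in> V" for i x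
    using F that by (auto simp: defining_map_def intro: C2_on_has_derivative)
  have dG: "(G j has_derivative (\<lambda>u. grad (G j) x \<bullet> u)) (at x)" if "x \<in> W" for x
    using G that j by (auto simp: defining_map_def intro: C2_on_has_derivative)
  have contF: "continuous_on (V \<inter> W) (F i)" if "i < r" for i
    using dF[OF that] has_derivative_continuous
    by (intro continuous_at_imp_continuous_on ballI) blast
  have contG: "continuous_on (V \<inter> W) (G j)"
    using dG has_derivative_continuous
    by (intro continuous_at_imp_continuous_on ballI) blast
  have cont: "continuous_on (V \<inter> W) \<Phi>"
    unfolding \<Phi>_def by (intro continuous_intros contF contG) auto
  have deriv: "(\<Phi> has_derivative T) (at c0)"
    unfolding \<Phi>_def T_def g_def k_def using c0VW
    by (auto intro!: derivative_eq_intros dF dG)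
  have N_perp: "(\<Sum>b\<in>B. (b \<bullet> u) *\<^sub>R b) \<in> N" for u
    using B subN by (auto intro!: subspace_sum subspace_mul)
  \<comment> \<open>Injectivity of \<open>T\<close>: the gradient part is orthogonal to
    \<open>v\<close> and to \<open>N\<close>, hence vanishes by itself; pairing with
    \<open>k\<close> then removes the \<open>v\<close> part. So \<open>u\<close> lies in
    \<open>N\<close> and is orthogonal to a basis of \<open>N\<close>.\<close>
  have T0: "u = 0" if "T u = 0" for u
  proof -
    define z where "z = (\<Sum>b\<in>B. (b \<bullet> u) *\<^sub>R b)"
    have z: "z \<in> N"
      unfolding z_def by (rule N_perp)
    have z_eq: "(\<Sum>i<r. (g i \<bullet> u) *\<^sub>R g i) + (k \<bullet> u) *\<^sub>R v + z = 0"
      using that by (simp add: T_def z_def)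
    have perp: "(\<Sum>i<r. (g i \<bullet> u) *\<^sub>R g i) \<bullet> w = 0" if "\<And>i. i < r \<Longrightarrow> g i \<bullet> w = 0" for w
      using that by (simp add: inner_sum_left)
    have "(\<Sum>i<r. (g i \<bullet> u) *\<^sub>R g i) \<bullet> ((k \<bullet> u) *\<^sub>R v) = 0"
      and "(\<Sum>i<r. (g i \<bullet> u) *\<^sub>R g i) \<bullet> z = 0"
      using z v by (auto simp: perp N_def g_def[symmetric])
    then have sum0: "(\<Sum>i<r. (g i \<bullet> u) *\<^sub>R g i) = 0"
      using orthogonal_sum_eq_0 z_eq by blast
    then have "(\<Sum>i<r. (g i \<bullet> u) *\<^sub>R g i) \<bullet> u = 0"
      by simp
    then have "(\<Sum>i<r. (g i \<bullet> u)\<^sup>2) = 0"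
      by (simp add: inner_sum_left power2_eq_square)
    then have gu: "g i \<bullet> u = 0" if "i < r" for i
      using that by (simp add: sum_nonneg_eq_0_iff)
    have "k \<bullet> ((k \<bullet> u) *\<^sub>R v + z) = 0"
      using z_eq sum0 by simp
    then have ku: "k \<bullet> u = 0"
      using z nz by (simp add: N_def k_def inner_right_distrib)
    then have "z \<bullet> u = 0"
      using z_eq sum0 by simp
    then have "(\<Sum>b\<in>B. (b \<bullet> u)\<^sup>2) = 0"
      by (simp add: z_def inner_sum_left power2_eq_square)
    then have "b \<bullet> u = 0" if "b \<in> B" for b
      using that finB by (simp add: sum_nonneg_eq_0_iff)
    moreover have "u \<in> span B"
      using B(3) gu ku by (auto simp: N_def)
    ultimately show "u = 0"
      using orthogonal_to_span[of u B u] by (simp add: orthogonal_def inner_commute)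
  qed
  have zeroF: "F i c0 = 0" if "i < r" for i
    using F c0 c0VW that by (auto simp: defining_map_def)
  have zeroG: "G j c0 = 0"
    using G c0 c0VW j by (auto simp: defining_map_def)
  have "\<Phi> c0 = 0"
    using zeroF zeroG by (simp add: \<Phi>_def)
  then have "0 \<in> interior (\<Phi> ` (V \<inter> W))"
    using surjective_derivative_open_map[OF openVW c0VW cont deriv T0] by simp
  then obtain \<epsilon> where \<epsilon>: "\<epsilon> > 0" "ball 0 \<epsilon> \<subseteq> \<Phi> ` (V \<inter> W)"
    by (meson mem_interior)
  have vnz: "v \<noteq> 0"
    using nz by auto
  define t where "t = \<epsilon> / (2 * norm v)"
  have "t \<noteq> 0" "t *\<^sub>R v \<in> ball 0 \<epsilon>"
    using \<epsilon>(1) vnz by (auto simp: t_def)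
  then have "t *\<^sub>R v \<in> \<Phi> ` (V \<inter> W)"
    using \<epsilon>(2) by blast
  then obtain x where "t *\<^sub>R v = \<Phi> x" "x \<in> V \<inter> W"
    by (rule imageE)
  then have x: "x \<in> V" "x \<in> W" "\<Phi> x = t *\<^sub>R v"
    by simp_all
  define z where "z = (\<Sum>b\<in>B. (b \<bullet> (x - c0)) *\<^sub>R b)"
  have z: "z \<in> N"
    unfolding z_def by (rule N_perp)
  have eq: "(\<Sum>i<r. F i x *\<^sub>R g i) + (G j x - t) *\<^sub>R v + z = 0"
    using x(3) by (simp add: \<Phi>_def z_def algebra_simps)
  moreover have "(\<Sum>i<r. F i x *\<^sub>R g i) \<bullet> ((G j x - t) *\<^sub>R v) = 0"
    and "(\<Sum>i<r. F i x *\<^sub>R g i) \<bullet> z = 0"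
    using z v by (auto simp: inner_sum_left N_def g_def)
  ultimately have sum0: "(\<Sum>i<r. F i x *\<^sub>R g i) = 0"
    using orthogonal_sum_eq_0 by blast
  have "c0 \<in> V"
    using c0VW by simp
  \<comment> \<open>Surjectivity of the derivative of \<open>F\<close> supplies a \<open>w\<close>
    that turns the vanishing combination into a sum of squares.\<close>
  then obtain w where w: "\<And>i. i < r \<Longrightarrow> g i \<bullet> w = F i x"
    using F unfolding defining_map_def g_def by metis
  have "(\<Sum>i<r. F i x *\<^sub>R g i) \<bullet> w = (\<Sum>i<r. (F i x)\<^sup>2)"
    using w by (simp add: inner_sum_left power2_eq_square)
  then have "\<forall>i<r. F i x = 0"
    using sum0 by (simp add: sum_nonneg_eq_0_iff)
  then have "x \<in> M"
    using F x by (auto simp: defining_map_def)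
  then have "G j x = 0"
    using G x j by (auto simp: defining_map_def)
  \<comment> \<open>This puts a nonzero multiple of \<open>v\<close> into \<open>N\<close>, which
    \<open>k\<close> annihilates although it does not annihilate \<open>v\<close>.\<close>
  then have "t *\<^sub>R v = z"
    using eq sum0 by (simp add: algebra_simps)
  then have "k \<bullet> (t *\<^sub>R v) = 0"
    using z by (simp add: N_def)
  then show False
    using nz \<open>t \<noteq> 0\<close> by (simp add: k_def)
qed

text \<open>A subspace of a Euclidean space is its own double orthogonal complement.\<close>

lemma span_eq_if_same_annihilator:
  fixes S T :: "'a::euclidean_space set"
  assumes "\<And>v. (\<forall>s\<in>S. s \<bullet> v = 0) \<longleftrightarrow> (\<forall>t\<in>T. t \<bullet> v = 0)"
  shows "span S = span T"
proof -
  have comp: "(span X)\<^sup>\<bottom> = {v. \<forall>x\<in>X. x \<bullet> v = 0}" for X :: "'a set"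
  proof
    show "{v. \<forall>x\<in>X. x \<bullet> v = 0} \<subseteq> (span X)\<^sup>\<bottom>"
    proof clarify
      fix v assume v: "\<forall>x\<in>X. x \<bullet> v = 0"
      have "orthogonal v y" if "y \<in> span X" for y
        using that by (rule orthogonal_to_span) (simp add: v orthogonal_def inner_commute)
      then show "v \<in> (span X)\<^sup>\<bottom>"
        by (simp add: orthogonal_comp_def orthogonal_commute)
    qed
  qed (auto simp: orthogonal_comp_def orthogonal_def span_base)
  have "(span S)\<^sup>\<bottom>\<^sup>\<bottom> = (span T)\<^sup>\<bottom>\<^sup>\<bottom>"
    unfolding comp[of S] comp[of T] using assms by simp
  then show ?thesis
    by (simp add: orthogonal_comp_self subspace_span)
qed

text \<open>The description in \<open>normal_space_def\<close> is unique:
  \<open>defining_map_kernel_subset\<close>, used in both directions, gives any two defining maps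
  the same kernel at \<open>c0\<close>.\<close>

lemma normal_space_eq:
  assumes F: "defining_map M c0 r V F" and c0: "c0 \<in> M"
  shows "normal_space c0 M = span ((\<lambda>i. grad (F i) c0) ` {..<r})"
  unfolding normal_space_def linear_combinations_eq_span
proof (rule the_equality)
  fix N
  assume "\<exists>r V F. defining_map M c0 r V F \<and> N = span ((\<lambda>i. grad (F i) c0) ` {..<r})"
  then obtain q W G where G: "defining_map M c0 q W G"
    and N: "N = span ((\<lambda>i. grad (G i) c0) ` {..<q})"
    by blast
  show "N = span ((\<lambda>i. grad (F i) c0) ` {..<r})"
    unfolding N
    by (rule span_eq_if_same_annihilator)
      (auto intro: defining_map_kernel_subset[OF F G c0] defining_map_kernel_subset[OF G F c0])
qed (use F in blast)

section \<open>Convexity and limits\<close>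

text \<open>Divide by \<open>t\<close> and let it tend to 0. This extracts the first-order term from
  the comparisons of quadratics along rays below.\<close>

lemma nonneg_if_quadratic_nonneg_at_right:
  fixes A B :: real
  assumes "\<forall>\<^sub>F t in at_right 0. 0 \<le> t * A + t\<^sup>2 * B"
  shows "0 \<le> A"
proof (rule tendsto_lowerbound)
  show "((\<lambda>t. A + t * B) \<longlongrightarrow> A) (at_right 0)"
    by (auto intro!: tendsto_eq_intros)
  show "\<forall>\<^sub>F t in at_right 0. 0 \<le> A + t * B"
    using assms eventually_at_right_less[of "0::real"]
  proof eventually_elim
    case (elim t)
    have "t * A + t\<^sup>2 * B = t * (A + t * B)"
      by (simp add: power2_eq_square algebra_simps)
    then show ?case
      using elim by (simp add: zero_le_mult_iff)
  qed
qed auto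

lemma eventually_at_right_in_open:
  fixes x v :: "'a::real_normed_vector"
  assumes "open V" "x \<in> V"
  shows "\<forall>\<^sub>F t in at_right 0. x + t *\<^sub>R v \<in> V"
proof -
  have "((\<lambda>t. x + t *\<^sub>R v) \<longlongrightarrow> x) (at_right 0)"
    by (auto intro!: tendsto_eq_intros)
  then show ?thesis
    using assms by (rule topological_tendstoD)
qed

text \<open>The segment from \<open>x\<close> to \<open>z\<close> can be prolonged past
  \<open>z\<close> within \<open>S\<close>; if \<open>f \<bullet> x < c\<close>, the prolonged point
  would violate the bound.\<close>

lemma equality_from_rel_interior:
  fixes S :: "'a::euclidean_space set"
  assumes "convex S" "z \<in> rel_interior S" "x \<in> S"
    and le: "\<And>y. y \<in> S \<Longrightarrow> f \<bullet> y \<le> c" and eq: "f \<bullet> z = c"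
  shows "f \<bullet> x = c"
proof -
  obtain t where t: "t > 1" "(1 - t) *\<^sub>R x + t *\<^sub>R z \<in> S"
    using assms convex_rel_interior_iff[of S z] by blast
  have "(1 - t) * (f \<bullet> x) + t * c \<le> c"
    using le[OF t(2)] eq by (simp add: inner_add_right)
  then have "(1 - t) * (f \<bullet> x - c) \<le> 0"
    by (simp add: algebra_simps)
  then have "f \<bullet> x - c \<ge> 0"
    using t(1) by (simp add: mult_le_0_iff)
  then show ?thesis
    using le[OF assms(3)] by simp
qed

lemma convex_epiD:
  assumes "convex (epi h)" "h x \<le> ereal r" "h z \<le> ereal q" "0 \<le> t" "t \<le> 1"
  shows "h ((1 - t) *\<^sub>R x + t *\<^sub>R z) \<le> ereal ((1 - t) * r + t * q)"
proof -
  have "(x, r) \<in> epi h" "(z, q) \<in> epi h"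
    using assms by (auto simp: epi_def)
  then have "(1 - t) *\<^sub>R (x, r) + t *\<^sub>R (z, q) \<in> epi h"
    using assms by (intro convexD) auto
  then show ?thesis
    by (simp add: epi_def)
qed

lemma finite_sets_separated:
  fixes L U :: "real set"
  assumes "finite L" "finite U" and less: "\<And>l u. l \<in> L \<Longrightarrow> u \<in> U \<Longrightarrow> l < u"
  obtains \<tau> where "\<And>l. l \<in> L \<Longrightarrow> l < \<tau>" "\<And>u. u \<in> U \<Longrightarrow> \<tau> < u"
proof (cases "U = {}")
  case True
  have "l < Max (insert 0 L) + 1" if "l \<in> L" for l
  proof -
    have "l \<le> Max (insert 0 L)"
      using that assms(1) by (intro Max_ge) auto
    then show ?thesis
      by simp
  qed
  then show ?thesis
    using that True by blast
next
  case False
  \<comment> \<open>Inserting \<open>Min U - 1\<close> keeps the maximum defined for empty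
    \<open>L\<close> without reaching \<open>Min U\<close>.\<close>
  define l0 where "l0 = Max (insert (Min U - 1) L)"
  have "Max (insert (Min U - 1) L) \<in> insert (Min U - 1) L"
    using assms(1) by (intro Max_in) auto
  moreover have "Min U \<in> U"
    using False assms(2) by (intro Min_in) auto
  ultimately have l0: "l0 < Min U"
    using less unfolding l0_def by auto
  have "l < (l0 + Min U) / 2" if "l \<in> L" for l
  proof -
    have "l \<le> l0"
      unfolding l0_def using that assms(1) by (intro Max_ge) auto
    then show ?thesis
      using l0 by simp
  qed
  moreover have "(l0 + Min U) / 2 < u" if "u \<in> U" for u
  proof -
    have "Min U \<le> u"
      using that assms(2) by (intro Min_le) auto
    then show ?thesis
      using l0 by simp
  qed
  ultimately show ?thesis
    using that by blast
qed

lemma finite_positive_lower_bound: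
  fixes f :: "'a \<Rightarrow> real"
  assumes "finite S" "\<And>x. x \<in> S \<Longrightarrow> 0 < f x"
  shows "\<exists>m>0. \<forall>x\<in>S. m \<le> f x"
proof (intro exI conjI ballI)
  show "0 < Min (insert 1 (f ` S))"
    using assms by (subst Min_gr_iff) auto
  show "Min (insert 1 (f ` S)) \<le> f x" if "x \<in> S" for x
    using assms(1) that by (intro Min_le) auto
qed

lemma affine_translated_subspace:
  assumes "subspace N"
  shows "affine {y. y - g \<in> N}"
proof -
  have "{y. y - g \<in> N} = (\<lambda>w. g + w) ` N"
    by (auto intro: image_eqI[where x = "y - g" for y])
  then show ?thesis
    using assms by (simp add: affine_translation[symmetric] subspace_imp_affine)
qed

text \<open>A nonempty relatively open part of an affine space has the whole space as affine hull,
  and \<open>S\<close> is squeezed between the two.\<close>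

lemma par_eqI:
  fixes S :: "'a::euclidean_space set"
  assumes N: "subspace N" and T: "open T" and S: "{y. y - g \<in> N} \<inter> T \<subseteq> S" "S \<subseteq> {y. y - g \<in> N}"
    and ne: "{y. y - g \<in> N} \<inter> T \<noteq> {}"
  shows "par S = N"
proof -
  let ?E = "{y. y - g \<in> N}"
  have aff: "affine ?E"
    using N by (rule affine_translated_subspace)
  have "affine hull (?E \<inter> T) = affine hull ?E"
    using affine_imp_convex[OF aff] T ne by (rule affine_hull_convex_Int_open)
  then have "?E \<subseteq> affine hull S"
    using hull_mono[OF S(1), of affine] aff hull_same by metis
  then have hull: "affine hull S = ?E"
    using S(2) aff by (simp add: hull_minimal subset_antisym)
  have "affine_parallel ?E N"
    unfolding affine_parallel_expl
    by (rule exI[of _ "- g"]) simp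
  then show ?thesis
    using N affine_parallel_subspace[OF aff] ne
    unfolding par_def hull by (intro the1_equality) auto
qed

lemma C2_on_affine: "C2_on V (\<lambda>x. w \<bullet> (x - c))"
  unfolding C2_on_def
proof (intro exI[of _ "\<lambda>_. w"] exI[of _ "\<lambda>_. 0"] conjI ballI)
  fix x
  show "GDERIV (\<lambda>x. w \<bullet> (x - c)) x :> w"
    unfolding gderiv_def by (auto intro!: derivative_eq_intros simp: inner_commute)
  show "((\<lambda>_. w) has_derivative (\<lambda>v. 0 *v v)) (at x)"
    by simp
qed simp

lemma grad_affine: "grad (\<lambda>x. w \<bullet> (x - c)) x = w"
  by (rule grad_eqI) (auto simp: gderiv_def inner_commute intro!: derivative_eq_intros)

section \<open>The active manifold\<close>

text \<open>Linear independence of the columns of \<open>A\<close> enters through a dual family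
  \<open>d\<close>: for \<open>w\<close> in their span, \<open>w \<bullet> d p\<close> is the
  coefficient of column \<open>p\<close>.\<close>

locale dual_basis_data = active_data h K s Q b \<beta> a \<alpha> \<omega> cbar kbar \<kappa> e A P
  for h :: "real^'m \<Rightarrow> ereal" and K s :: nat
    and Q :: "nat \<Rightarrow> real^'m^'m" and b :: "nat \<Rightarrow> real^'m" and \<beta> :: "nat \<Rightarrow> real"
    and a :: "nat \<Rightarrow> real^'m" and \<alpha> :: "nat \<Rightarrow> real" and \<omega> :: "nat \<Rightarrow> nat \<Rightarrow> real"
    and cbar :: "real^'m" and kbar :: nat and \<kappa> :: "nat \<Rightarrow> nat" and e :: "'l::finite \<Rightarrow> nat"
    and A :: "real^'l^'m" and P :: "nat \<Rightarrow> real^'l^'l" +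
  fixes d :: "'l \<Rightarrow> real^'m"
  assumes dual: "\<And>p q. column q A \<bullet> d p = (if q = p then 1 else 0)"
begin

abbreviation "M \<equiv> active_manifold K s a \<alpha> \<omega> cbar"
abbreviation "C k \<equiv> piece s a \<alpha> \<omega> k"
abbreviation "u p \<equiv> column p A"
abbreviation "\<sigma> i p \<equiv> P i $ p $ p"

definition quad :: "nat \<Rightarrow> real^'m \<Rightarrow> real" where
  "quad k x = 1/2 * (x \<bullet> (Q k *v x)) + b k \<bullet> x + \<beta> k"

text \<open>The gradient of \<open>quad (\<kappa> i)\<close> for an active piece, by symmetry of
  \<open>Q (\<kappa> i)\<close>.\<close>

definition G :: "nat \<Rightarrow> real^'m \<Rightarrow> real^'m" where
  "G i x = Q (\<kappa> i) *v x + b (\<kappa> i)"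

text \<open>The constraints inactive at \<open>cbar\<close> have the same sign on all active pieces, so
  \<open>\<kappa> 1\<close> stands for any of them.\<close>

definition V :: "(real^'m) set" where
  "V = {x. \<forall>j\<in>{1..s} - active_constraints s a \<alpha> cbar.
    \<omega> (\<kappa> 1) j * (a j \<bullet> x) < \<omega> (\<kappa> 1) j * \<alpha> j}"

lemma \<kappa>_mem: "i \<in> {1..kbar} \<Longrightarrow> \<kappa> i \<in> {1..K} \<and> cbar \<in> C (\<kappa> i)"
  using \<kappa>_enum bij_betwE by (fastforce simp: active_pieces_def)

lemma active_piecesE:
  assumes "k \<in> active_pieces K s a \<alpha> \<omega> cbar"
  obtains i where "i \<in> {1..kbar}" "k = \<kappa> i"
  using assms \<kappa>_enum by (metis bij_betw_imp_surj_on imageE)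

lemma one_mem: "1 \<in> {1..kbar}"
  using kbar_ge_2 by simp

lemma e_mem: "e p \<in> {1..s} \<and> a (e p) \<bullet> cbar = \<alpha> (e p)"
  using e_enum bij_betwE by (fastforce simp: active_constraints_def)

lemma active_constraintsE:
  assumes "j \<in> active_constraints s a \<alpha> cbar"
  obtains p where "j = e p"
  using assms e_enum by (metis bij_betw_imp_surj_on imageE)

lemma \<sigma>_sign: "i \<in> {1..kbar} \<Longrightarrow> \<sigma> i p = 1 \<or> \<sigma> i p = -1"
  using P_sign by blast

lemma column_mult_P:
  assumes "i \<in> {1..kbar}"
  shows "column p (A ** P i) = \<sigma> i p *\<^sub>R u p"
proof -
  have "(\<Sum>q\<in>UNIV. A $ r $ q * P i $ q $ p) = \<sigma> i p * A $ r $ p" for r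
  proof -
    have "(\<Sum>q\<in>UNIV. A $ r $ q * P i $ q $ p) = (\<Sum>q\<in>UNIV. if q = p then A $ r $ q * P i $ q $ p else 0)"
      using P_diagonal[OF assms] by (intro sum.cong) auto
    then show ?thesis
      by simp
  qed
  then show ?thesis
    by (simp add: vec_eq_iff column_def matrix_matrix_mult_def)
qed

lemma signed_active:
  assumes "i \<in> {1..kbar}"
  shows "\<omega> (\<kappa> i) (e p) *\<^sub>R a (e p) = \<sigma> i p *\<^sub>R u p"
  using AP_column[OF assms] column_mult_P[OF assms] by metis

lemma active_le_iff:
  assumes "i \<in> {1..kbar}"
  shows "(\<omega> (\<kappa> i) (e p) *\<^sub>R a (e p)) \<bullet> x \<le> \<omega> (\<kappa> i) (e p) * \<alpha> (e p)
    \<longleftrightarrow> \<sigma> i p * (u p \<bullet> (x - cbar)) \<le> 0"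
proof -
  have "(\<omega> (\<kappa> i) (e p) *\<^sub>R a (e p)) \<bullet> cbar = \<omega> (\<kappa> i) (e p) * \<alpha> (e p)"
    using e_mem by simp
  moreover have "(\<omega> (\<kappa> i) (e p) *\<^sub>R a (e p)) \<bullet> (x - cbar) = \<sigma> i p * (u p \<bullet> (x - cbar))"
    using signed_active[OF assms] by simp
  ultimately show ?thesis
    by (simp only: inner_diff_right) linarith
qed

text \<open>An inactive constraint is strict at \<open>cbar\<close>, so its sign is dictated by the
  side on which \<open>cbar\<close> lies.\<close>

lemma \<omega>_inactive:
  assumes "i \<in> {1..kbar}" "j \<in> {1..s} - active_constraints s a \<alpha> cbar"
  shows "\<omega> (\<kappa> i) j = \<omega> (\<kappa> 1) j"
proof -
  have *: "\<omega> (\<kappa> i) j * (a j \<bullet> cbar - \<alpha> j) \<le> 0 \<and> \<omega> (\<kappa> i) j \<in> {-1, 1}" if "i \<in> {1..kbar}" for i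
    using \<kappa>_mem[OF that] \<omega>_sign assms(2) by (fastforce simp: piece_def algebra_simps)
  have "a j \<bullet> cbar \<noteq> \<alpha> j"
    using assms(2) by (auto simp: active_constraints_def)
  then show ?thesis
    using *[OF assms(1)] *[OF one_mem] by auto
qed

lemma cbar_V: "cbar \<in> V"
proof -
  have "\<omega> (\<kappa> 1) j * (a j \<bullet> cbar) < \<omega> (\<kappa> 1) j * \<alpha> j"
    if "j \<in> {1..s} - active_constraints s a \<alpha> cbar" for j
  proof -
    have "\<omega> (\<kappa> 1) j * (a j \<bullet> cbar) \<le> \<omega> (\<kappa> 1) j * \<alpha> j"
      using that \<kappa>_mem[OF one_mem] by (auto simp: piece_def)
    moreover have "a j \<bullet> cbar \<noteq> \<alpha> j" "\<omega> (\<kappa> 1) j \<noteq> 0"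
      using that \<kappa>_mem[OF one_mem] \<omega>_sign[of "\<kappa> 1" j] by (auto simp: active_constraints_def)
    ultimately show ?thesis
      by (simp add: less_le)
  qed
  then show ?thesis
    by (auto simp: V_def)
qed

lemma open_V: "open V"
proof -
  have "V = (\<Inter>j\<in>{1..s} - active_constraints s a \<alpha> cbar.
    {x. \<omega> (\<kappa> 1) j * (a j \<bullet> x) < \<omega> (\<kappa> 1) j * \<alpha> j})"
    by (auto simp: V_def)
  also have "open \<dots>"
    by (intro open_INT ballI open_Collect_less continuous_intros) auto
  finally show ?thesis .
qed

text \<open>On \<open>V\<close> the inactive constraints hold automatically, and the active ones are
  tight at \<open>cbar\<close>, so they depend on \<open>x - cbar\<close> alone.\<close>

lemma piece_iff:
  assumes "i \<in> {1..kbar}" "x \<in> V"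
  shows "x \<in> C (\<kappa> i) \<longleftrightarrow> (\<forall>p. \<sigma> i p * (u p \<bullet> (x - cbar)) \<le> 0)"
proof
  assume "x \<in> C (\<kappa> i)"
  then show "\<forall>p. \<sigma> i p * (u p \<bullet> (x - cbar)) \<le> 0"
    using e_mem active_le_iff[OF assms(1)] unfolding piece_def by blast
next
  assume *: "\<forall>p. \<sigma> i p * (u p \<bullet> (x - cbar)) \<le> 0"
  have "(\<omega> (\<kappa> i) j *\<^sub>R a j) \<bullet> x \<le> \<omega> (\<kappa> i) j * \<alpha> j" if j: "j \<in> {1..s}" for j
  proof (cases "j \<in> active_constraints s a \<alpha> cbar")
    case True
    then show ?thesis
      using * active_le_iff[OF assms(1)] by (metis active_constraintsE)
  next
    case False
    then have "\<omega> (\<kappa> i) j = \<omega> (\<kappa> 1) j"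
      using \<omega>_inactive[OF assms(1)] j by blast
    then show ?thesis
      using False j assms(2) by (auto simp: V_def intro: less_imp_le)
  qed
  then show "x \<in> C (\<kappa> i)"
    by (simp add: piece_def)
qed

lemma closed_piece: "closed (C k)"
proof -
  have "C k = (\<Inter>j\<in>{1..s}. {x. (\<omega> k j *\<^sub>R a j) \<bullet> x \<le> \<omega> k j * \<alpha> j})"
    by (auto simp: piece_def)
  also have "closed \<dots>"
    by (intro closed_INT ballI closed_Collect_le continuous_intros)
  finally show ?thesis .
qed

lemma convex_piece: "convex (C k)"
proof -
  have "C k = (\<Inter>j\<in>{1..s}. {x. (\<omega> k j *\<^sub>R a j) \<bullet> x \<le> \<omega> k j * \<alpha> j})"
    by (auto simp: piece_def)
  also have "convex \<dots>"
    by (intro convex_INT convex_halfspace_le)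
  finally show ?thesis .
qed

text \<open>Constraints tight at the relative interior point \<open>cbar\<close> are tight on the
  whole intersection \<open>S\<close>, so \<open>S\<close> lies in the affine space
  \<open>E\<close>. Since \<open>E \<inter> V\<close> is relatively open in \<open>E\<close> and
  contained in \<open>S\<close>, it lies in the relative interior. Conversely, an inactive
  constraint tight at a relative interior point would be tight at \<open>cbar\<close>.\<close>

lemma M_eq: "M = {x \<in> V. \<forall>p. u p \<bullet> (x - cbar) = 0}"
proof -
  define S where "S = (\<Inter>k\<in>active_pieces K s a \<alpha> \<omega> cbar. C k)"
  define E where "E = {x. \<forall>p. u p \<bullet> (x - cbar) = 0}"
  have M: "M = rel_interior S"
    by (simp add: active_manifold_def S_def)
  have S_subset: "S \<subseteq> C (\<kappa> i)" if "i \<in> {1..kbar}" for i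
    using \<kappa>_mem[OF that] by (auto simp: S_def active_pieces_def)
  have convS: "convex S"
    unfolding S_def by (intro convex_INT convex_piece)
  have cbarS: "cbar \<in> rel_interior S" "cbar \<in> S"
    using cbar_manifold rel_interior_subset unfolding M by auto
  have SE: "S \<subseteq> E"
  proof
    fix x assume x: "x \<in> S"
    have "u p \<bullet> (x - cbar) = 0" for p
    proof -
      have \<sigma>: "\<sigma> 1 p \<noteq> 0"
        using \<sigma>_sign[OF one_mem, of p] by auto
      have "(\<sigma> 1 p *\<^sub>R u p) \<bullet> x = (\<sigma> 1 p *\<^sub>R u p) \<bullet> cbar"
      proof (rule equality_from_rel_interior[OF convS cbarS(1) x])
        fix y assume "y \<in> S"
        then have "y \<in> C (\<kappa> 1)"
          using S_subset one_mem by blast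
        then have "\<sigma> 1 p * (u p \<bullet> (y - cbar)) \<le> 0"
          using e_mem active_le_iff[OF one_mem] unfolding piece_def by blast
        then show "(\<sigma> 1 p *\<^sub>R u p) \<bullet> y \<le> (\<sigma> 1 p *\<^sub>R u p) \<bullet> cbar"
          by (simp add: inner_diff_right algebra_simps)
      qed simp
      then show ?thesis
        using \<sigma> by (simp add: inner_diff_right)
    qed
    then show "x \<in> E"
      by (simp add: E_def)
  qed
  have "affine E"
    unfolding affine_def E_def
  proof (clarsimp)
    fix x y s t p
    assume "\<forall>p. u p \<bullet> (x - cbar) = 0" "\<forall>p. u p \<bullet> (y - cbar) = 0" and st: "s + t = (1::real)"
    then have eq: "u p \<bullet> x = u p \<bullet> cbar" "u p \<bullet> y = u p \<bullet> cbar"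
      by (auto simp: inner_diff_right)
    have "s * (u p \<bullet> cbar) + t * (u p \<bullet> cbar) = (s + t) * (u p \<bullet> cbar)"
      by (simp add: algebra_simps)
    then show "u p \<bullet> (s *\<^sub>R x + t *\<^sub>R y - cbar) = 0"
      using eq st by (simp add: inner_add_right inner_diff_right)
  qed
  then have hullE: "affine hull S \<subseteq> E"
    using SE by (simp add: hull_minimal)
  have EV: "E \<inter> V \<subseteq> S"
    using piece_iff by (auto simp: S_def E_def elim!: active_piecesE)
  have "rel_interior S = E \<inter> V"
  proof
    show "E \<inter> V \<subseteq> rel_interior S"
    proof
      fix x assume "x \<in> E \<inter> V"
      then show "x \<in> rel_interior S"
        unfolding mem_rel_interior
        using open_V EV hullE by (intro exI[of _ V]) auto
    qed
    show "rel_interior S \<subseteq> E \<inter> V"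
    proof
      fix x assume x: "x \<in> rel_interior S"
      then have xS: "x \<in> S"
        using rel_interior_subset by blast
      have "\<omega> (\<kappa> 1) j * (a j \<bullet> x) < \<omega> (\<kappa> 1) j * \<alpha> j"
        if j: "j \<in> {1..s} - active_constraints s a \<alpha> cbar" for j
      proof (rule ccontr)
        have le: "(\<omega> (\<kappa> 1) j *\<^sub>R a j) \<bullet> y \<le> \<omega> (\<kappa> 1) j * \<alpha> j" if "y \<in> S" for y
          using j that S_subset[OF one_mem] by (auto simp: piece_def)
        assume "\<not> \<omega> (\<kappa> 1) j * (a j \<bullet> x) < \<omega> (\<kappa> 1) j * \<alpha> j"
        then have "(\<omega> (\<kappa> 1) j *\<^sub>R a j) \<bullet> x = \<omega> (\<kappa> 1) j * \<alpha> j"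
          using le[OF xS] by simp
        then have "(\<omega> (\<kappa> 1) j *\<^sub>R a j) \<bullet> cbar = \<omega> (\<kappa> 1) j * \<alpha> j"
          using equality_from_rel_interior[OF convS x cbarS(2)] le by blast
        moreover have "\<omega> (\<kappa> 1) j * (a j \<bullet> cbar) < \<omega> (\<kappa> 1) j * \<alpha> j"
          using cbar_V j unfolding V_def by blast
        ultimately show False
          by auto
      qed
      then show "x \<in> E \<inter> V"
        using xS SE by (auto simp: V_def)
    qed
  qed
  then show ?thesis
    unfolding M by (auto simp: E_def)
qed

subsection \<open>The subdifferential on the active manifold\<close>

lemma quad_expand:
  assumes "k \<in> {1..K}"
  shows "quad k (x + t *\<^sub>R v) = quad k x + t * ((Q k *v x + b k) \<bullet> v) + t\<^sup>2 * ((v \<bullet> (Q k *v v)) / 2)"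
proof -
  have "v \<bullet> (Q k *v x) = (Q k *v x) \<bullet> v" "x \<bullet> (Q k *v v) = (Q k *v x) \<bullet> v"
    using Q_sym[OF assms] by (metis inner_commute dot_lmul_matrix transpose_matrix_vector)+
  then show ?thesis
    by (simp add: quad_def matrix_vector_right_distrib matrix_vector_mult_scaleR inner_add_left
        inner_add_right power2_eq_square algebra_simps)
qed

lemma quad_expand_G:
  assumes "i \<in> {1..kbar}"
  shows "quad (\<kappa> i) (x + t *\<^sub>R v)
    = quad (\<kappa> i) x + t * (G i x \<bullet> v) + t\<^sup>2 * ((v \<bullet> (Q (\<kappa> i) *v v)) / 2)"
  using quad_expand \<kappa>_mem[OF assms] unfolding G_def by blast

lemma h_piece: "k \<in> {1..K} \<Longrightarrow> x \<in> C k \<Longrightarrow> h x = ereal (quad k x)"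
  using h_eq unfolding quad_def .

lemma M_piece: "x \<in> M \<Longrightarrow> i \<in> {1..kbar} \<Longrightarrow> x \<in> C (\<kappa> i)"
  using piece_iff M_eq by simp

lemma h_M:
  assumes "x \<in> M" "i \<in> {1..kbar}"
  shows "h x = ereal (quad (\<kappa> i) x)"
  using h_piece M_piece[OF assms] \<kappa>_mem[OF assms(2)] by blast

lemma quad_eq_on_M:
  assumes "x \<in> M" "i \<in> {1..kbar}" "i' \<in> {1..kbar}"
  shows "quad (\<kappa> i) x = quad (\<kappa> i') x"
  using h_M[OF assms(1,2)] h_M[OF assms(1,3)] by simp

text \<open>\<open>x\<close> and \<open>cbar\<close> lie strictly on the same side of each inactive
  constraint, so \<open>cbar\<close> satisfies it whenever \<open>x\<close> does; the active ones
  are equalities at \<open>cbar\<close>, whatever their sign.\<close>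

lemma active_piece_of_M:
  assumes x: "x \<in> M" "x \<in> C k" "k \<in> {1..K}"
  obtains i where "i \<in> {1..kbar}" "k = \<kappa> i"
proof -
  have "(\<omega> k j *\<^sub>R a j) \<bullet> cbar \<le> \<omega> k j * \<alpha> j" if j: "j \<in> {1..s}" for j
  proof (cases "j \<in> active_constraints s a \<alpha> cbar")
    case True
    then show ?thesis
      by (simp add: active_constraints_def)
  next
    case False
    have "\<omega> (\<kappa> 1) j * (a j \<bullet> x) < \<omega> (\<kappa> 1) j * \<alpha> j" "\<omega> (\<kappa> 1) j * (a j \<bullet> cbar) < \<omega> (\<kappa> 1) j * \<alpha> j"
      using x(1) cbar_V M_eq False j by (auto simp: V_def)
    moreover have "\<omega> (\<kappa> 1) j \<in> {-1, 1}"
      by (rule \<omega>_sign[OF conjunct1[OF \<kappa>_mem[OF one_mem]] j])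
    moreover have "\<omega> k j \<in> {-1, 1}"
      by (rule \<omega>_sign[OF x(3) j])
    moreover have "\<omega> k j * (a j \<bullet> x) \<le> \<omega> k j * \<alpha> j"
      using x(2) j by (auto simp: piece_def)
    ultimately show ?thesis
      by auto
  qed
  then have "k \<in> active_pieces K s a \<alpha> \<omega> cbar"
    using x(3) by (simp add: active_pieces_def piece_def)
  then show ?thesis
    using that by (rule active_piecesE)
qed

text \<open>The ray stays in the open set \<open>V\<close> for small \<open>t\<close>, and the
  active constraints, tight at \<open>x\<close>, grow linearly along \<open>v\<close>.\<close>

lemma eventually_in_piece:
  assumes x: "x \<in> M" and i: "i \<in> {1..kbar}" and v: "\<And>p. \<sigma> i p * (u p \<bullet> v) \<le> 0"
  shows "\<forall>\<^sub>F t in at_right 0. x + t *\<^sub>R v \<in> C (\<kappa> i)"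
proof -
  have "x \<in> V" and ux: "\<And>p. u p \<bullet> (x - cbar) = 0"
    using x M_eq by auto
  show ?thesis
    using eventually_at_right_in_open[OF open_V \<open>x \<in> V\<close>, of v] eventually_at_right_less[of "0::real"]
  proof eventually_elim
    case (elim t)
    have "\<sigma> i p * (u p \<bullet> (x + t *\<^sub>R v - cbar)) \<le> 0" for p
    proof -
      have "u p \<bullet> (x + t *\<^sub>R v - cbar) = t * (u p \<bullet> v)"
        using ux[of p] by (simp add: inner_diff_right inner_add_right)
      then have eq: "\<sigma> i p * (u p \<bullet> (x + t *\<^sub>R v - cbar)) = t * (\<sigma> i p * (u p \<bullet> v))"
        by (simp only: mult.left_commute)
      show ?thesis
        unfolding eq by (intro mult_nonneg_nonpos less_imp_le[OF elim(2)] v)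
    qed
    then show ?case
      using piece_iff[OF i elim(1)] by blast
  qed
qed

text \<open>The ray enters piece \<open>i\<close>, where the subgradient inequality is compared to
  first order with the expansion of the quadratic.\<close>

lemma subgradient_directional:
  assumes x: "x \<in> M" and i: "i \<in> {1..kbar}" and v: "\<And>p. \<sigma> i p * (u p \<bullet> v) \<le> 0"
    and y: "y \<in> subdiff h x"
  shows "y \<bullet> v \<le> G i x \<bullet> v"
proof -
  have "\<forall>\<^sub>F t in at_right 0. 0 \<le> t * ((G i x - y) \<bullet> v) + t\<^sup>2 * ((v \<bullet> (Q (\<kappa> i) *v v)) / 2)"
    using eventually_in_piece[OF x i v]
  proof eventually_elim
    case (elim t)
    have "h x + ereal (y \<bullet> (x + t *\<^sub>R v - x)) \<le> h (x + t *\<^sub>R v)"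
      using y unfolding subdiff_def by blast
    then show ?case
      using h_piece[OF _ elim] \<kappa>_mem[OF i] h_M[OF x i] quad_expand_G[OF i, of x t v]
      by (simp add: inner_diff_left algebra_simps)
  qed
  then have "0 \<le> (G i x - y) \<bullet> v"
    by (rule nonneg_if_quadratic_nonneg_at_right)
  then show ?thesis
    by (simp add: inner_diff_left)
qed

text \<open>Moving along \<open>d p\<close> changes the \<open>p\<close>-th coordinate alone, so
  \<open>x - t d p\<close> and \<open>x + t d p\<close> lie in pieces \<open>i\<close> and
  \<open>i'\<close> for small \<open>t\<close>. Convexity at their midpoint \<open>x\<close> gives
  the sign of the first-order term.\<close>

lemma kink_nonneg:
  assumes x: "x \<in> M" and i: "i \<in> {1..kbar}" "i' \<in> {1..kbar}"
    and \<sigma>: "\<sigma> i p = 1" "\<sigma> i' p = -1"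
  shows "0 \<le> (G i' x - G i x) \<bullet> d p"
proof -
  have "\<forall>\<^sub>F t in at_right 0. 0 \<le> t * ((G i' x - G i x) \<bullet> d p)
    + t\<^sup>2 * ((d p \<bullet> (Q (\<kappa> i) *v d p)) / 2 + (d p \<bullet> (Q (\<kappa> i') *v d p)) / 2)"
  proof -
    have "\<forall>\<^sub>F t in at_right 0. x + t *\<^sub>R (- d p) \<in> C (\<kappa> i)"
      by (rule eventually_in_piece[OF x i(1)]) (simp add: dual \<sigma>)
    moreover have "\<forall>\<^sub>F t in at_right 0. x + t *\<^sub>R d p \<in> C (\<kappa> i')"
      by (rule eventually_in_piece[OF x i(2)]) (simp add: dual \<sigma>)
    ultimately show ?thesis
    proof eventually_elim
      case (elim t)
      have "h (x + (- t) *\<^sub>R d p) = ereal (quad (\<kappa> i) (x + (- t) *\<^sub>R d p))"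
        "h (x + t *\<^sub>R d p) = ereal (quad (\<kappa> i') (x + t *\<^sub>R d p))"
        using elim h_piece[of "\<kappa> i" "x + (- t) *\<^sub>R d p"] h_piece \<kappa>_mem i by auto
      moreover have "(1 - 1/2) *\<^sub>R (x + (- t) *\<^sub>R d p) + (1/2) *\<^sub>R (x + t *\<^sub>R d p) = x"
        by (simp add: vec_eq_iff field_simps)
      ultimately have "h x \<le> ereal ((1 - 1/2) * quad (\<kappa> i) (x + (- t) *\<^sub>R d p)
          + (1/2) * quad (\<kappa> i') (x + t *\<^sub>R d p))"
        using convex_epiD[OF convex, of "x + (- t) *\<^sub>R d p" _ "x + t *\<^sub>R d p" _ "1/2"] by fastforce
      then have "2 * quad (\<kappa> i) x \<le> quad (\<kappa> i) (x + (- t) *\<^sub>R d p) + quad (\<kappa> i') (x + t *\<^sub>R d p)"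
        using h_M[OF x i(1)] by simp
      then show ?case
        using quad_eq_on_M[OF x i]
        unfolding quad_expand_G[OF i(1)] quad_expand_G[OF i(2)]
        by (simp add: inner_diff_left algebra_simps)
    qed
  qed
  then show ?thesis
    by (rule nonneg_if_quadratic_nonneg_at_right)
qed

text \<open>A ray tangent to \<open>M\<close> stays in both pieces for small \<open>t\<close>, so
  both quadratics equal \<open>h\<close> there. The limit argument yields an inequality; exchanging
  \<open>i\<close> and \<open>i'\<close> makes it an equality.\<close>

lemma G_tangent_le:
  assumes x: "x \<in> M" and i: "i \<in> {1..kbar}" "i' \<in> {1..kbar}" and v: "\<And>p. u p \<bullet> v = 0"
  shows "G i x \<bullet> v \<le> G i' x \<bullet> v"
proof -
  have "\<forall>\<^sub>F t in at_right 0. 0 \<le> t * ((G i' x - G i x) \<bullet> v)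
    + t\<^sup>2 * ((v \<bullet> (Q (\<kappa> i') *v v)) / 2 - (v \<bullet> (Q (\<kappa> i) *v v)) / 2)"
  proof -
    have "\<forall>\<^sub>F t in at_right 0. x + t *\<^sub>R v \<in> C (\<kappa> j)" if "j \<in> {1..kbar}" for j
      by (rule eventually_in_piece[OF x that]) (simp add: v)
    from this[OF i(1)] this[OF i(2)] show ?thesis
    proof eventually_elim
      case (elim t)
      have "quad (\<kappa> i) (x + t *\<^sub>R v) = quad (\<kappa> i') (x + t *\<^sub>R v)"
        using h_piece[OF _ elim(1)] h_piece[OF _ elim(2)] \<kappa>_mem i by simp
      then show ?case
        using quad_eq_on_M[OF x i]
        unfolding quad_expand_G[OF i(1)] quad_expand_G[OF i(2)]
        by (simp add: inner_diff_left algebra_simps)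
    qed
  qed
  then have "0 \<le> (G i' x - G i x) \<bullet> v"
    by (rule nonneg_if_quadratic_nonneg_at_right)
  then show ?thesis
    by (simp add: inner_diff_left)
qed

lemma G_tangent_eq:
  assumes "x \<in> M" "i \<in> {1..kbar}" "i' \<in> {1..kbar}" "\<And>p. u p \<bullet> v = 0"
  shows "G i x \<bullet> v = G i' x \<bullet> v"
  using G_tangent_le[OF assms(1,2,3)] G_tangent_le[OF assms(1,3,2)] assms(4) by (meson order.antisym)

text \<open>The annihilator of the tangent space of \<open>M\<close>. In this form membership
  follows from tangential equalities; \<open>N_eq_span\<close> identifies it with the column span of
  \<open>A\<close>.\<close>

definition N :: "(real^'m) set" where
  "N = {w. \<forall>v. (\<forall>p. u p \<bullet> v = 0) \<longrightarrow> w \<bullet> v = 0}"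

lemma N_expand:
  assumes "w \<in> N"
  shows "w = (\<Sum>p\<in>UNIV. (w \<bullet> d p) *\<^sub>R u p)"
proof -
  have "w \<bullet> z = (\<Sum>p\<in>UNIV. (w \<bullet> d p) *\<^sub>R u p) \<bullet> z" for z
  proof -
    \<comment> \<open>Removing the dual-basis part from \<open>z\<close> leaves a tangent vector,
      which \<open>w\<close> annihilates.\<close>
    define v where "v = z - (\<Sum>p\<in>UNIV. (u p \<bullet> z) *\<^sub>R d p)"
    have "u q \<bullet> v = 0" for q
    proof -
      have "u q \<bullet> (\<Sum>p\<in>UNIV. (u p \<bullet> z) *\<^sub>R d p) = (\<Sum>p\<in>UNIV. if q = p then u p \<bullet> z else 0)"
        unfolding inner_sum_right by (rule sum.cong) (auto simp: dual)
      then show ?thesis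
        by (simp add: v_def inner_diff_right)
    qed
    then have "w \<bullet> v = 0"
      using assms by (simp add: N_def)
    then show ?thesis
      by (simp add: v_def inner_diff_right inner_sum_right inner_sum_left mult.commute)
  qed
  then show ?thesis
    by (metis vector_eq_rdot)
qed

lemma N_eq_span: "N = span (range u)"
proof
  show "N \<subseteq> span (range u)"
  proof
    fix w assume "w \<in> N"
    moreover have "(\<Sum>p\<in>UNIV. (w \<bullet> d p) *\<^sub>R u p) \<in> span (range u)"
      by (intro span_sum span_scale span_base rangeI)
    ultimately show "w \<in> span (range u)"
      using N_expand by metis
  qed
  have "subspace N"
    by (auto simp: N_def subspace_def inner_add_left)
  then show "span (range u) \<subseteq> N"
    by (intro span_minimal) (auto simp: N_def)
qed

text \<open>Along the segment from \<open>x\<close> to any \<open>z\<close> in the domain,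
  \<open>h\<close> lies below its chord by convexity. Near \<open>x\<close> the segment runs in
  active pieces, whose first-order bounds \<open>dir\<close> therefore control the slope of the
  chord.\<close>

lemma subdiffI:
  assumes x: "x \<in> M"
    and N: "y - G 1 x \<in> N" and y: "\<And>i p. i \<in> {1..kbar} \<Longrightarrow> 0 \<le> \<sigma> i p * ((y - G i x) \<bullet> d p)"
  shows "y \<in> subdiff h x"
proof -
  have yN: "y - G i x \<in> N" if "i \<in> {1..kbar}" for i
    using N G_tangent_eq[OF x one_mem that] by (simp add: N_def inner_diff_left)
  \<comment> \<open>In coordinates the inner product is a sum of products of factors with opposite
    signs.\<close>
  have dir: "y \<bullet> v \<le> G i x \<bullet> v" if i: "i \<in> {1..kbar}" and v: "\<And>p. \<sigma> i p * (u p \<bullet> v) \<le> 0" for i v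
  proof -
    have "(y - G i x) \<bullet> v = (\<Sum>p\<in>UNIV. ((y - G i x) \<bullet> d p) * (u p \<bullet> v))"
      by (subst N_expand[OF yN[OF i]]) (simp add: inner_sum_left)
    also have "\<dots> \<le> 0"
    proof (rule sum_nonpos)
      fix p
      show "((y - G i x) \<bullet> d p) * (u p \<bullet> v) \<le> 0"
        using y[OF i, of p] v[of p] \<sigma>_sign[OF i, of p] by (auto simp: mult_le_0_iff)
    qed
    finally show ?thesis
      by (simp add: inner_diff_left)
  qed
  have hx: "h x = ereal (quad (\<kappa> 1) x)"
    by (rule h_M[OF x one_mem])
  have "h x + ereal (y \<bullet> (z - x)) \<le> h z" for z
  proof (cases "h z = \<infinity>")
    case False
    have "h z \<noteq> -\<infinity>"
      using proper by (simp add: proper_def)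
    then obtain r where r: "h z = ereal r"
      using False by (cases "h z") auto
    define v where "v = z - x"
    \<comment> \<open>The active piece met below may vary with \<open>t\<close>; \<open>R\<close>
      bounds the second-order terms of all of them at once.\<close>
    define R where "R = (\<Sum>i\<in>{1..kbar}. \<bar>v \<bullet> (Q (\<kappa> i) *v v)\<bar> / 2)"
    have R: "- R \<le> (v \<bullet> (Q (\<kappa> i) *v v)) / 2" if "i \<in> {1..kbar}" for i
    proof -
      have "\<bar>v \<bullet> (Q (\<kappa> i) *v v)\<bar> / 2 \<le> R"
        unfolding R_def by (rule member_le_sum) (use that in auto)
      then show ?thesis
        by linarith
    qed
    \<comment> \<open>Pieces not containing \<open>x\<close> are closed and finite in number, so the
      segment avoids them near \<open>x\<close>.\<close>
    have "open (- (\<Union>k\<in>{k \<in> {1..K}. x \<notin> C k}. C k))"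
      using closed_piece by (intro open_Compl closed_UN) auto
    then have "\<forall>\<^sub>F t in at_right 0. x + t *\<^sub>R v \<in> - (\<Union>k\<in>{k \<in> {1..K}. x \<notin> C k}. C k)"
      by (rule eventually_at_right_in_open) auto
    moreover have "x \<in> V"
      using x M_eq by simp
    then have "\<forall>\<^sub>F t in at_right 0. x + t *\<^sub>R v \<in> V"
      by (rule eventually_at_right_in_open[OF open_V])
    moreover have "\<forall>\<^sub>F t in at_right (0::real). t < 1"
      by (rule eventually_at_right_real[THEN eventually_mono]) auto
    ultimately have "\<forall>\<^sub>F t in at_right 0. 0 \<le> t * (r - quad (\<kappa> 1) x - y \<bullet> v) + t\<^sup>2 * R"
      using eventually_at_right_less[of "0::real"]
    proof eventually_elim
      case (elim t)
      have "x + t *\<^sub>R v = (1 - t) *\<^sub>R x + t *\<^sub>R z"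
        by (simp add: v_def algebra_simps)
      then have le: "h (x + t *\<^sub>R v) \<le> ereal ((1 - t) * quad (\<kappa> 1) x + t * r)"
        using convex_epiD[OF convex, of x "quad (\<kappa> 1) x" z r t] hx r elim by simp
      then have "x + t *\<^sub>R v \<in> edom h"
        by (auto simp: edom_def intro: le_less_trans)
      then obtain k where k: "k \<in> {1..K}" "x + t *\<^sub>R v \<in> C k"
        using dom_eq by blast
      then have "x \<in> C k"
        using elim(1) by blast
      then obtain i where i: "i \<in> {1..kbar}" "k = \<kappa> i"
        using active_piece_of_M[OF x _ k(1)] by blast
      have "\<sigma> i p * (u p \<bullet> v) \<le> 0" for p
      proof -
        have "u p \<bullet> (x + t *\<^sub>R v - cbar) = t * (u p \<bullet> v)"
          using x M_eq by (simp add: inner_add_right inner_diff_right)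
        then have "t * (\<sigma> i p * (u p \<bullet> v)) \<le> 0"
          using k(2) piece_iff[OF i(1) elim(2)] i(2) by (metis mult.left_commute)
        then show ?thesis
          using elim(4) by (simp add: mult_le_0_iff)
      qed
      then have "t * (y \<bullet> v) \<le> t * (G i x \<bullet> v)"
        using dir[OF i(1)] elim(4) by simp
      moreover have "t\<^sup>2 * (- R) \<le> t\<^sup>2 * ((v \<bullet> (Q (\<kappa> i) *v v)) / 2)"
        using R[OF i(1)] by (rule mult_left_mono) simp
      moreover have "quad (\<kappa> i) (x + t *\<^sub>R v) \<le> (1 - t) * quad (\<kappa> 1) x + t * r"
        using le h_piece[OF k] i(2) by simp
      ultimately show ?case
        using quad_eq_on_M[OF x i(1) one_mem] quad_expand_G[OF i(1), of x t v]
        by (simp add: algebra_simps)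
    qed
    then have "0 \<le> r - quad (\<kappa> 1) x - y \<bullet> v"
      by (rule nonneg_if_quadratic_nonneg_at_right)
    then show ?thesis
      using r hx by (simp add: v_def)
  qed simp
  moreover have "x \<in> edom h"
    using hx by (simp add: edom_def)
  ultimately show ?thesis
    by (simp add: subdiff_def)
qed

text \<open>The box description of the subdifferential. Membership in the box follows by testing a
  subgradient along tangent vectors of both signs and along the signed dual vectors.\<close>

lemma subdiff_eq:
  assumes x: "x \<in> M"
  shows "subdiff h x
    = {y. y - G 1 x \<in> N \<and> (\<forall>i\<in>{1..kbar}. \<forall>p. 0 \<le> \<sigma> i p * ((y - G i x) \<bullet> d p))}"
proof (intro set_eqI iffI)
  fix y assume y: "y \<in> subdiff h x"
  have "y - G 1 x \<in> N"
    unfolding N_def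
  proof (intro CollectI allI impI)
    fix v assume v: "\<forall>p. u p \<bullet> v = 0"
    have "y \<bullet> v \<le> G 1 x \<bullet> v" "y \<bullet> (- v) \<le> G 1 x \<bullet> (- v)"
      by (rule subgradient_directional[OF x one_mem _ y], simp add: v)+
    then show "(y - G 1 x) \<bullet> v = 0"
      by (simp add: inner_diff_left)
  qed
  moreover have "0 \<le> \<sigma> i p * ((y - G i x) \<bullet> d p)" if i: "i \<in> {1..kbar}" for i p
  proof -
    \<comment> \<open>The direction \<open>- \<sigma> i p *\<^sub>R d p\<close> points into piece
      \<open>i\<close> for either sign.\<close>
    have "y \<bullet> (- \<sigma> i p *\<^sub>R d p) \<le> G i x \<bullet> (- \<sigma> i p *\<^sub>R d p)"
      by (rule subgradient_directional[OF x i _ y]) (simp add: dual)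
    then show ?thesis
      by (simp add: inner_diff_left algebra_simps)
  qed
  ultimately show "y \<in> {y. y - G 1 x \<in> N \<and> (\<forall>i\<in>{1..kbar}. \<forall>p. 0 \<le> \<sigma> i p * ((y - G i x) \<bullet> d p))}"
    by blast
qed (use subdiffI[OF x] in blast)

subsection \<open>Smoothness data of the active manifold\<close>

lemma C2_on_quad:
  assumes "k \<in> {1..K}"
  shows "C2_on UNIV (quad k)"
  unfolding C2_on_def
proof (intro exI[of _ "\<lambda>x. Q k *v x + b k"] exI[of _ "\<lambda>_. Q k"] conjI ballI)
  fix x
  have Q: "((\<lambda>x. Q k *v x) has_derivative (\<lambda>v. Q k *v v)) (at x)" for x
    by (intro bounded_linear_imp_has_derivative matrix_vector_mul_bounded_linear)
  show "((\<lambda>x. Q k *v x + b k) has_derivative (\<lambda>v. Q k *v v)) (at x)"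
    by (auto intro!: derivative_eq_intros Q)
  have *: "x \<bullet> (Q k *v v) = (Q k *v x) \<bullet> v" for v
    using Q_sym[OF assms] by (metis dot_lmul_matrix transpose_matrix_vector)
  have "(quad k has_derivative
      (\<lambda>v. 1/2 * (x \<bullet> (Q k *v v) + v \<bullet> (Q k *v x)) + b k \<bullet> v)) (at x)"
    unfolding quad_def[abs_def]
    by (intro has_derivative_add_const has_derivative_add has_derivative_mult_right
        has_derivative_inner has_derivative_inner_right has_derivative_ident Q)
  moreover have "(\<lambda>v. 1/2 * (x \<bullet> (Q k *v v) + v \<bullet> (Q k *v x)) + b k \<bullet> v)
      = (\<lambda>v. v \<bullet> (Q k *v x + b k))"
    by (simp add: fun_eq_iff * inner_add_right inner_commute)
  ultimately show "GDERIV (quad k) x :> Q k *v x + b k"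
    by (simp add: gderiv_def)
qed simp

lemma continuous_on_quad: "continuous_on S (quad k)"
  unfolding quad_def[abs_def]
  by (intro continuous_intros matrix_vector_mult_linear_continuous_on)

text \<open>On each of the finitely many closed pieces \<open>h\<close> is a continuous quadratic,
  so the epigraph is a finite union of closed sets.\<close>

lemma closed_epi: "closed (epi h)"
proof -
  have "epi h = (\<Union>k\<in>{1..K}. {z. fst z \<in> C k \<and> quad k (fst z) \<le> snd z})" (is "_ = ?R")
  proof
    show "epi h \<subseteq> ?R"
    proof
      fix z assume "z \<in> epi h"
      then have z: "h (fst z) \<le> ereal (snd z)"
        by (auto simp: epi_def)
      then have "fst z \<in> edom h"
        by (auto simp: edom_def intro: le_less_trans)
      then obtain k where "k \<in> {1..K}" "fst z \<in> C k"
        using dom_eq by blast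
      then show "z \<in> ?R"
        using z h_piece by force
    qed
    show "?R \<subseteq> epi h"
      using h_piece by (fastforce simp: epi_def)
  qed
  also have "closed \<dots>"
  proof (intro closed_UN ballI)
    fix k assume "k \<in> {1..K}"
    have "continuous_on UNIV (\<lambda>z :: (real^'m) \<times> real. quad k (fst z))"
      by (rule continuous_on_compose2[OF continuous_on_quad[of UNIV]]) (auto intro: continuous_intros)
    then have "closed {z. quad k (fst z) \<le> snd z}"
      by (intro closed_Collect_le continuous_intros)
    moreover have "closed {z :: (real^'m) \<times> real. fst z \<in> C k}"
      using closed_vimage_fst[OF closed_piece] by (simp add: vimage_def)
    ultimately show "closed {z. fst z \<in> C k \<and> quad k (fst z) \<le> snd z}"
      by (rule closed_Collect_conj[rotated])
  qed simp
  finally show ?thesis .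
qed

text \<open>The active constraints are affine with constant gradients, the columns of
  \<open>A\<close>; the dual family solves the linear system that surjectivity requires.\<close>

lemma defining_map_M:
  assumes x: "x \<in> M" and f: "bij_betw f {..<r} (UNIV :: 'l set)"
  shows "defining_map M x r V (\<lambda>i z. u (f i) \<bullet> (z - cbar))"
  unfolding defining_map_def grad_affine
proof (intro conjI allI impI ballI C2_on_affine open_V)
  show "x \<in> V"
    using x M_eq by simp
  fix w :: "nat \<Rightarrow> real"
  show "\<exists>v. \<forall>i<r. u (f i) \<bullet> v = w i"
  proof (intro exI allI impI)
    fix i assume i: "i < r"
    have "u (f i) \<bullet> (\<Sum>j<r. w j *\<^sub>R d (f j)) = (\<Sum>j<r. if i = j then w j else 0)"
      unfolding inner_sum_right
      using i bij_betw_imp_inj_on[OF f] by (intro sum.cong) (auto simp: dual inj_on_def)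
    then show "u (f i) \<bullet> (\<Sum>j<r. w j *\<^sub>R d (f j)) = w i"
      using i by simp
  qed
next
  have "(\<forall>p. u p \<bullet> (z - cbar) = 0) \<longleftrightarrow> (\<forall>i<r. u (f i) \<bullet> (z - cbar) = 0)" for z
    using bij_betw_imp_surj_on[OF f] by (metis UNIV_I imageE lessThan_iff)
  then show "M \<inter> V = {z \<in> V. \<forall>i<r. u (f i) \<bullet> (z - cbar) = 0}"
    unfolding M_eq by auto
qed

lemma enumeration_of_columns:
  obtains f where "bij_betw f {..<CARD('l)} (UNIV :: 'l set)"
  using ex_bij_betw_nat_finite[of "UNIV :: 'l set"] by (auto simp: atLeast0LessThan)

lemma manifold_around_M: "x \<in> M \<Longrightarrow> manifold_around M x"
  unfolding manifold_around_def using defining_map_M enumeration_of_columns by metis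

lemma normal_space_M:
  assumes "x \<in> M"
  shows "normal_space x M = N"
proof -
  obtain f where f: "bij_betw f {..<CARD('l)} (UNIV :: 'l set)"
    by (rule enumeration_of_columns)
  have "(\<lambda>i. u (f i)) ` {..<CARD('l)} = u ` f ` {..<CARD('l)}"
    by (simp only: image_image)
  also have "\<dots> = range u"
    by (simp only: bij_betw_imp_surj_on[OF f])
  finally have "(\<lambda>i. u (f i)) ` {..<CARD('l)} = range u" .
  then show ?thesis
    using normal_space_eq[OF defining_map_M[OF assms f] assms] by (simp add: grad_affine N_eq_span)
qed

text \<open>\<open>M\<close> is an affine space cut by the open set \<open>V\<close>, so the line
  from \<open>z\<close> through \<open>x\<close> can be followed slightly beyond
  \<open>x\<close>.\<close>

lemma eventually_extrapolation_in_M: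
  assumes "x \<in> M" "z \<in> M"
  shows "\<forall>\<^sub>F t in at_right 0. x + t *\<^sub>R (x - z) \<in> M"
proof -
  have "x \<in> V" and E: "\<And>p. u p \<bullet> (x - cbar) = 0" "\<And>p. u p \<bullet> (z - cbar) = 0"
    using assms M_eq by auto
  have "u p \<bullet> (x + t *\<^sub>R (x - z) - cbar) = 0" for p t
    using E[of p] by (simp add: inner_diff_right inner_add_right)
  then show ?thesis
    using eventually_at_right_in_open[OF open_V \<open>x \<in> V\<close>] by (simp add: M_eq)
qed

lemma G_extrapolation: "G i (x + t *\<^sub>R (x - z)) = G i x + t *\<^sub>R (G i x - G i z)"
  by (simp add: G_def matrix_vector_right_distrib matrix_vector_mult_scaleR
      matrix_vector_mult_diff_distrib scaleR_diff_right)

text \<open>The kink of \<open>h\<close> across a constraint is affine and nonnegative along the relatively open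
  \<open>M\<close>, so it is positive everywhere on \<open>M\<close> as soon as it is positive somewhere.\<close>

lemma kink_pos:
  assumes x: "x \<in> M" and z: "z \<in> M" and i: "i \<in> {1..kbar}" "i' \<in> {1..kbar}"
    and \<sigma>: "\<sigma> i p = 1" "\<sigma> i' p = -1"
    and pos: "0 < (G i' z - G i z) \<bullet> d p"
  shows "0 < (G i' x - G i x) \<bullet> d p"
proof -
  have "\<forall>\<^sub>F t in at_right (0::real). t > 0 \<and> x + t *\<^sub>R (x - z) \<in> M"
    using eventually_extrapolation_in_M[OF x z] eventually_at_right_less by (rule eventually_conj[rotated])
  then obtain t :: real where t: "t > 0" "x + t *\<^sub>R (x - z) \<in> M"
    using eventually_happens'[OF trivial_limit_at_right_real] by blast
  define D where "D w = (G i' w - G i w) \<bullet> d p" for w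
  \<comment> \<open>\<open>x\<close> lies strictly between \<open>z\<close> and the prolonged point:
    \<open>(1 + t) * D x\<close> is a nonnegative value plus the positive
    \<open>t * D z\<close>.\<close>
  have "D (x + t *\<^sub>R (x - z)) = D x + t * (D x - D z)"
    unfolding D_def G_extrapolation by (simp add: inner_diff_left inner_add_left algebra_simps)
  moreover have "0 \<le> D (x + t *\<^sub>R (x - z))"
    unfolding D_def by (rule kink_nonneg[OF t(2) i \<sigma>])
  moreover have "0 < t * D z"
    using t(1) pos by (simp add: D_def)
  ultimately have "0 < (1 + t) * D x"
    by (simp add: algebra_simps)
  then show ?thesis
    using t(1) by (simp add: D_def zero_less_mult_iff)
qed

end

section \<open>Partial smoothness when all gaps are positive on the active manifold\<close>

locale kinked_data = dual_basis_data +
  assumes kinked: "\<And>x i i' p. x \<in> M \<Longrightarrow> i \<in> {1..kbar} \<Longrightarrow> i' \<in> {1..kbar} \<Longrightarrow>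
    \<sigma> i p = 1 \<Longrightarrow> \<sigma> i' p = -1 \<Longrightarrow> 0 < (G i' x - G i x) \<bullet> d p"
begin

text \<open>Positive gaps allow each coordinate to be placed, independently of the others, strictly
  between its lower and upper bounds; a combination of columns then realizes the chosen
  coordinates.\<close>

lemma strict_subgradient:
  assumes x: "x \<in> M"
  obtains y where "y - G 1 x \<in> N"
    "\<And>i p. i \<in> {1..kbar} \<Longrightarrow> 0 < \<sigma> i p * ((y - G i x) \<bullet> d p)"
proof -
  have "\<exists>\<tau>. \<forall>i\<in>{1..kbar}. 0 < \<sigma> i p * (\<tau> - G i x \<bullet> d p)" for p
  proof -
    \<comment> \<open>Pieces of sign 1 give lower bounds, pieces of sign -1 upper bounds; either
      family may be empty.\<close>
    define L where "L = (\<lambda>i. G i x \<bullet> d p) ` {i \<in> {1..kbar}. \<sigma> i p = 1}"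
    define U where "U = (\<lambda>i. G i x \<bullet> d p) ` {i \<in> {1..kbar}. \<sigma> i p = -1}"
    have less: "l < v" if "l \<in> L" "v \<in> U" for l v
      using kinked[OF x] that unfolding L_def U_def by (force simp: inner_diff_left)
    obtain \<tau> where \<tau>: "\<And>l. l \<in> L \<Longrightarrow> l < \<tau>" "\<And>v. v \<in> U \<Longrightarrow> \<tau> < v"
      using finite_sets_separated[of L U, OF _ _ less] by (auto simp: L_def U_def)
    have "0 < \<sigma> i p * (\<tau> - G i x \<bullet> d p)" if i: "i \<in> {1..kbar}" for i
      using \<sigma>_sign[OF i, of p]
    proof
      assume "\<sigma> i p = 1"
      then show ?thesis
        using \<tau>(1)[of "G i x \<bullet> d p"] i by (auto simp: L_def)
    next
      assume "\<sigma> i p = -1"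
      then show ?thesis
        using \<tau>(2)[of "G i x \<bullet> d p"] i by (auto simp: U_def)
    qed
    then show ?thesis
      by blast
  qed
  then obtain \<tau> where \<tau>: "\<And>p i. i \<in> {1..kbar} \<Longrightarrow> 0 < \<sigma> i p * (\<tau> p - G i x \<bullet> d p)"
    by metis
  define w where "w = (\<Sum>p\<in>UNIV. (\<tau> p - G 1 x \<bullet> d p) *\<^sub>R u p)"
  have w: "w \<bullet> d q = \<tau> q - G 1 x \<bullet> d q" for q
  proof -
    have "w \<bullet> d q = (\<Sum>p\<in>UNIV. if p = q then \<tau> p - G 1 x \<bullet> d p else 0)"
      unfolding w_def inner_sum_left by (rule sum.cong) (auto simp: dual)
    then show ?thesis
      by simp
  qed
  have "w \<in> N"
    unfolding w_def N_eq_span by (intro span_sum span_scale span_base rangeI)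
  then show ?thesis
    using that[of "G 1 x + w"] \<tau> by (simp add: inner_diff_left inner_add_left w)
qed

lemma subdiff_nonempty:
  assumes x: "x \<in> M"
  shows "subdiff h x \<noteq> {}"
proof -
  obtain y where y: "y - G 1 x \<in> N"
    "\<And>i p. i \<in> {1..kbar} \<Longrightarrow> 0 < \<sigma> i p * ((y - G i x) \<bullet> d p)"
    using strict_subgradient[OF x] by blast
  have "y \<in> subdiff h x"
    by (rule subdiffI[OF x y(1) less_imp_le[OF y(2)]])
  then show ?thesis
    by blast
qed

lemma subspace_N: "subspace N"
  unfolding N_eq_span by (rule subspace_span)

text \<open>The strict bounds define an open set \<open>T\<close> that meets the affine space
  \<open>G 1 x + N\<close> in a strict subgradient, and this intersection lies in the
  subdifferential.\<close>

lemma par_subdiff: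
  assumes x: "x \<in> M"
  shows "par (subdiff h x) = N"
proof (rule par_eqI[OF subspace_N])
  define T where "T = (\<Inter>i\<in>{1..kbar}. \<Inter>p. {y. 0 < \<sigma> i p * ((y - G i x) \<bullet> d p)})"
  show "open T"
    unfolding T_def by (intro open_INT ballI open_Collect_less continuous_intros) auto
  show "{y. y - G 1 x \<in> N} \<inter> T \<subseteq> subdiff h x"
    unfolding subdiff_eq[OF x] T_def by (auto intro: less_imp_le)
  show "subdiff h x \<subseteq> {y. y - G 1 x \<in> N}"
    unfolding subdiff_eq[OF x] by blast
  obtain y where "y - G 1 x \<in> N" "\<And>i p. i \<in> {1..kbar} \<Longrightarrow> 0 < \<sigma> i p * ((y - G i x) \<bullet> d p)"
    using strict_subgradient[OF x] by blast
  then have "y \<in> {y. y - G 1 x \<in> N} \<inter> T"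
    by (auto simp: T_def)
  then show "{y. y - G 1 x \<in> N} \<inter> T \<noteq> {}"
    by blast
qed

lemma isCont_G: "isCont (G i) x"
  unfolding G_def[abs_def]
  by (intro continuous_intros linear_continuous_at matrix_vector_mul_bounded_linear)

text \<open>
  A subgradient \<open>y\<close> at \<open>x\<close> is moved towards a strict subgradient \<open>y0\<close> just enough to make up
  for the change \<open>\<eta>\<close> of the bounds in \<open>subdiff_eq\<close>, then translated into the affine hull of the
  subdifferential at the nearby point.
\<close>

lemma inner_semicontinuous_subdiff:
  assumes x: "x \<in> M"
  shows "inner_semicontinuous_at (subdiff h) x M"
  unfolding inner_semicontinuous_at_def
proof (intro ballI allI impI)
  fix y X
  assume y: "y \<in> subdiff h x" and "(\<forall>n. X n \<in> M) \<and> X \<longlonglongrightarrow> x"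
  then have X: "\<And>n. X n \<in> M" and X_lim: "X \<longlonglongrightarrow> x"
    by auto
  obtain y0 where y0: "y0 - G 1 x \<in> N"
    "\<And>i p. i \<in> {1..kbar} \<Longrightarrow> 0 < \<sigma> i p * ((y0 - G i x) \<bullet> d p)"
    using strict_subgradient[OF x] by blast
  \<comment> \<open>\<open>m\<close> is the slack that \<open>y0\<close> has in all bounds
    simultaneously.\<close>
  have "\<exists>m>0. \<forall>z\<in>{1..kbar} \<times> UNIV. m \<le> \<sigma> (fst z) (snd z) * ((y0 - G (fst z) x) \<bullet> d (snd z))"
    by (rule finite_positive_lower_bound) (auto intro: y0(2))
  then obtain m where m: "0 < m"
    "\<And>i p. i \<in> {1..kbar} \<Longrightarrow> m \<le> \<sigma> i p * ((y0 - G i x) \<bullet> d p)"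
    by fastforce
  \<comment> \<open>Translating by \<open>G 1 (X n) - G 1 x\<close> follows the bounds of piece 1
    exactly; \<open>\<delta> i p n\<close> is the drift of piece \<open>i\<close> relative to
    it.\<close>
  define \<delta> where "\<delta> i p n = ((G 1 (X n) - G i (X n)) - (G 1 x - G i x)) \<bullet> d p" for i p n
  define \<eta> where "\<eta> n = (\<Sum>i\<in>{1..kbar}. \<Sum>p\<in>UNIV. \<bar>\<delta> i p n\<bar>)" for n
  \<comment> \<open>With this weight on \<open>y0\<close> the slack gained is at least
    \<open>\<epsilon> n * m = \<eta> n\<close>, which covers every single drift.\<close>
  define \<epsilon> where "\<epsilon> n = \<eta> n / m" for n
  define Y where "Y n = (1 - \<epsilon> n) *\<^sub>R y + \<epsilon> n *\<^sub>R y0 + (G 1 (X n) - G 1 x)" for n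
  have G_lim: "(\<lambda>n. G i (X n)) \<longlonglongrightarrow> G i x" for i
    using isCont_G X_lim by (rule isCont_tendsto_compose)
  have "\<delta> i p \<longlonglongrightarrow> 0" for i p
    unfolding \<delta>_def[abs_def] by (rule tendsto_eq_intros G_lim refl | simp)+
  then have "(\<lambda>n. \<Sum>p\<in>UNIV. \<bar>\<delta> i p n\<bar>) \<longlonglongrightarrow> 0" for i
    by (rule tendsto_null_sum[OF tendsto_rabs_zero])
  then have "\<eta> \<longlonglongrightarrow> 0"
    unfolding \<eta>_def[abs_def] by (rule tendsto_null_sum)
  then have \<epsilon>_lim: "\<epsilon> \<longlonglongrightarrow> 0"
    unfolding \<epsilon>_def[abs_def] using m(1) by (auto intro!: tendsto_eq_intros)
  have "Y \<longlonglongrightarrow> y"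
    unfolding Y_def[abs_def] by (rule tendsto_eq_intros G_lim \<epsilon>_lim refl | simp)+
  moreover have "\<forall>\<^sub>F n in sequentially. \<epsilon> n < 1"
    using \<epsilon>_lim by (rule order_tendstoD) simp
  then have "\<forall>\<^sub>F n in sequentially. Y n \<in> subdiff h (X n)"
  proof eventually_elim
    case (elim n)
    have \<delta>_le: "\<bar>\<delta> i p n\<bar> \<le> \<epsilon> n * m" if "i \<in> {1..kbar}" for i p
    proof -
      have "\<bar>\<delta> i p n\<bar> \<le> (\<Sum>p\<in>UNIV. \<bar>\<delta> i p n\<bar>)"
        by (rule member_le_sum) auto
      also have "\<dots> \<le> \<eta> n"
        unfolding \<eta>_def by (rule member_le_sum[OF that]) (auto intro: sum_nonneg)
      finally show ?thesis
        using m(1) by (simp add: \<epsilon>_def)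
    qed
    have "0 \<le> \<eta> n"
      unfolding \<eta>_def by (intro sum_nonneg) auto
    then have \<epsilon>: "0 \<le> \<epsilon> n"
      using m(1) by (simp add: \<epsilon>_def)
    have yN: "y - G 1 x \<in> N" and y_ge: "\<And>i p. i \<in> {1..kbar} \<Longrightarrow> 0 \<le> \<sigma> i p * ((y - G i x) \<bullet> d p)"
      using y subdiff_eq[OF x] by auto
    have "Y n - G 1 (X n) = (1 - \<epsilon> n) *\<^sub>R (y - G 1 x) + \<epsilon> n *\<^sub>R (y0 - G 1 x)"
      by (simp add: Y_def algebra_simps)
    then have "Y n - G 1 (X n) \<in> N"
      using yN y0(1) subspace_N by (auto intro: subspace_add subspace_mul)
    moreover have "0 \<le> \<sigma> i p * ((Y n - G i (X n)) \<bullet> d p)" if i: "i \<in> {1..kbar}" for i p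
    proof -
      have "Y n - G i (X n) = (1 - \<epsilon> n) *\<^sub>R (y - G i x) + \<epsilon> n *\<^sub>R (y0 - G i x)
          + ((G 1 (X n) - G i (X n)) - (G 1 x - G i x))"
        by (simp add: Y_def algebra_simps)
      then have "\<sigma> i p * ((Y n - G i (X n)) \<bullet> d p) = (1 - \<epsilon> n) * (\<sigma> i p * ((y - G i x) \<bullet> d p))
          + \<epsilon> n * (\<sigma> i p * ((y0 - G i x) \<bullet> d p)) + \<sigma> i p * \<delta> i p n"
        unfolding \<delta>_def by (simp only: inner_add_left inner_scaleR_left) (simp only: algebra_simps)
      moreover have "0 \<le> (1 - \<epsilon> n) * (\<sigma> i p * ((y - G i x) \<bullet> d p))"
        using elim y_ge[OF i] by simp
      moreover have "\<epsilon> n * m \<le> \<epsilon> n * (\<sigma> i p * ((y0 - G i x) \<bullet> d p))"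
        using \<epsilon> m(2)[OF i] by (rule mult_left_mono[rotated])
      moreover have "- (\<epsilon> n * m) \<le> \<sigma> i p * \<delta> i p n"
        using \<delta>_le[OF i, of p] \<sigma>_sign[OF i, of p] by auto
      ultimately show ?thesis
        by linarith
    qed
    ultimately show ?case
      by (rule subdiffI[OF X])
  qed
  ultimately show "\<exists>U. U \<longlonglongrightarrow> y \<and> (\<forall>\<^sub>F n in sequentially. U n \<in> subdiff h (X n))"
    by blast
qed

lemma partly_smooth_M: "partly_smooth h M"
  unfolding partly_smooth_def is_manifold_def partly_smooth_at_def
proof (intro conjI ballI)
  fix x assume x: "x \<in> M"
  show "closed_proper_convex h"
    unfolding closed_proper_convex_def using closed_epi proper convex by blast
  show "\<exists>V f. open V \<and> x \<in> V \<and> C2_on V f \<and> (\<forall>z\<in>V \<inter> M. h z = ereal (f z))"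
    \<comment> \<open>On \<open>M\<close> all active quadratics agree with \<open>h\<close>, so that
      of piece \<open>\<kappa> 1\<close> is a smooth representative on the whole space.\<close>
    using C2_on_quad \<kappa>_mem[OF one_mem] h_M[OF _ one_mem]
    by (intro exI[of _ UNIV] exI[of _ "quad (\<kappa> 1)"]) auto
  show "\<forall>\<^sub>F z in nhds x. z \<in> M \<longrightarrow> subdiff h z \<noteq> {}"
    using subdiff_nonempty by simp
  show "par (subdiff h x) = normal_space x M"
    using par_subdiff[OF x] normal_space_M[OF x] by simp
qed (simp_all add: manifold_around_M inner_semicontinuous_subdiff)

end

section \<open>From nondegeneracy and strict complementarity to positive gaps\<close>

theorem theorem6p2:
  fixes h :: "real^'m \<Rightarrow> ereal" and K s :: nat
    and Q :: "nat \<Rightarrow> real^'m^'m" and b :: "nat \<Rightarrow> real^'m" and \<beta> :: "nat \<Rightarrow> real"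
    and a :: "nat \<Rightarrow> real^'m" and \<alpha> :: "nat \<Rightarrow> real" and \<omega> :: "nat \<Rightarrow> nat \<Rightarrow> real"
    and cbar :: "real^'m" and kbar :: nat and \<kappa> :: "nat \<Rightarrow> nat" and e :: "'l::finite \<Rightarrow> nat"
    and A :: "real^'l^'m" and P :: "nat \<Rightarrow> real^'l^'l"
    and c y :: "real^'m"
  assumes setting: "active_data h K s Q b \<beta> a \<alpha> \<omega> cbar kbar \<kappa> e A P"
    and nondegenerate: "{v. A *v v = 0} = {0}"
    and "c \<in> active_manifold K s a \<alpha> \<omega> cbar"
    and "y \<in> subdiff h c"
    and "\<exists>\<mu>. k_strict_complementarity h Q b (active_manifold K s a \<alpha> \<omega> cbar) kbar \<kappa> A P c y \<mu>"
  shows "partly_smooth h (active_manifold K s a \<alpha> \<omega> cbar)"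
proof -
  have "inj ((*v) A)"
  proof (rule injI)
    fix v w assume "A *v v = A *v w"
    then have "v - w \<in> {v. A *v v = 0}"
      by (simp add: matrix_vector_mult_diff_distrib)
    then show "v = w"
      using nondegenerate by simp
  qed
  \<comment> \<open>The rows of a left inverse of \<open>A\<close> form the dual family.\<close>
  then obtain B where B: "B ** A = mat 1"
    using matrix_left_invertible_injective by blast
  have dual: "column q A \<bullet> row p B = (if q = p then 1 else 0)" for p q
  proof -
    have "column q A \<bullet> row p B = (B ** A) $ p $ q"
      by (simp add: matrix_mult_dot inner_vec_def column_def row_def matrix_matrix_mult_def mult.commute)
    then show ?thesis
      using B by (auto simp: mat_def)
  qed
  interpret dual_basis_data h K s Q b \<beta> a \<alpha> \<omega> cbar kbar \<kappa> e A P "\<lambda>p. row p B"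
    using setting dual by (simp add: dual_basis_data_def dual_basis_data_axioms_def)
  obtain \<mu> i0 where i0: "i0 \<in> {1..kbar}" "\<And>p. 0 < \<mu> i0 $ p"
    and zero: "\<And>i p i'. i \<in> {1..kbar} - {i0} \<Longrightarrow> \<mu> i $ p = 0 \<Longrightarrow> i' \<in> {1..kbar} \<Longrightarrow> P i' $ p $ p = 1"
    and nonneg: "\<And>i p. i \<in> {1..kbar} \<Longrightarrow> 0 \<le> \<mu> i $ p"
    and y: "\<And>i. i \<in> {1..kbar} \<Longrightarrow> y = Q (\<kappa> i) *v c + b (\<kappa> i) + (A ** P i) *v \<mu> i"
    using assms(5) unfolding k_strict_complementarity_def by metis
  \<comment> \<open>In dual coordinates the multipliers measure, up to sign, the distance of
    \<open>y\<close> from the bounds of piece \<open>i\<close>.\<close>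
  have yd: "(y - G i c) \<bullet> row p B = P i $ p $ p * \<mu> i $ p" if i: "i \<in> {1..kbar}" for i p
  proof -
    have "y - G i c = (\<Sum>q\<in>UNIV. \<mu> i $ q *\<^sub>R (P i $ q $ q *\<^sub>R column q A))"
      using y[OF i] column_mult_P[OF i] by (simp add: G_def matrix_mult_sum scalar_mult_eq_scaleR)
    then have "(y - G i c) \<bullet> row p B = (\<Sum>q\<in>UNIV. if q = p then \<mu> i $ q * P i $ q $ q else 0)"
      by (simp add: inner_sum_left dual if_distrib cong: if_cong)
    then show ?thesis
      by (simp add: mult.commute)
  qed
  \<comment> \<open>The gap at \<open>c\<close> is the sum of the two multipliers, because the signs
    of the pieces are opposite.\<close>
  have "0 < (G i' c - G i c) \<bullet> row p B"
    if i: "i \<in> {1..kbar}" "i' \<in> {1..kbar}" and P: "P i $ p $ p = 1" "P i' $ p $ p = -1" for i i' p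
  proof -
    have "0 < \<mu> j $ p" if "j \<in> {1..kbar}" for j
    proof -
      \<comment> \<open>Outside block \<open>i0\<close> a zero multiplier would force sign 1 on all
        pieces, contradicting the sign -1 of piece \<open>i'\<close>.\<close>
      have "\<mu> j $ p \<noteq> 0"
        using zero[of j p i'] i0(2)[of p] that i(2) P(2) by (cases "j = i0") auto
      then show ?thesis
        using nonneg[OF that, of p] by simp
    qed
    from this[OF i(1)] this[OF i(2)] have "0 < \<mu> i $ p + \<mu> i' $ p"
      by simp
    then show ?thesis
      using yd[OF i(1), of p] yd[OF i(2), of p] P by (simp add: inner_diff_left)
  qed
  \<comment> \<open>\<open>kink_pos\<close> carries positivity of the gaps from \<open>c\<close> to
    all of \<open>M\<close>.\<close>
  then interpret kinked_data h K s Q b \<beta> a \<alpha> \<omega> cbar kbar \<kappa> e A P "\<lambda>p. row p B"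
    using kink_pos[OF _ assms(3)] by unfold_locales blast
  show ?thesis
    by (rule partly_smooth_M)
qed

end
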